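(* Let $H$ be a closed subspace of $L^2(G\times Y)$ that is invariant under the translation representation $\rho_{G\times Y}$ of $G$, and let $\widehat{H}=(F\otimes I)(H)$. Then $\widehat{H}$ is the direct integral of the spaces $\widehat{H}_\xi$: \[ \widehat{H}=\int^{\oplus}_{\Omega}\widehat{H}_\xi\,\mathrm{d}\widehat{\nu}(\xi). \]
   Context: $G$ is a locally compact abelian group (written additively) with a Haar measure $\nu$, and $Y$ is a measure space with a measure $\lambda$. It is assumed that $G$ is $\sigma$-compact and metrizable, $\lambda$ is $\sigma$-finite, and $L^2(G,\nu)$ and $L^2(Y,\lambda)$ are separable. $G\times Y$ carries the product measure. $\widehat{G}$ is the dual group; $\widehat{\nu}$ is the dual Haar measure, so that the Fourier transform $(F_1f)(\xi)=\int_G\overline{\xi(x)}f(x)\,\mathrm{d}\nu(x)$ extends from $L^1(G)\cap L^2(G)$ to a unitary operator $F\colon L^2(G)\to L^2(\widehat{G},\widehat{\nu})$; $F\otimes I=F\otimes I_{L^2(Y)}\colon L^2(G\times Y)\to L^2(\widehat{G}\times Y)$. $(\rho_{G\times Y}(a)f)(u,v)=f(u-a,v)$; $P$ is the orthogonal projection of $L^2(G\times Y)$ onto $H$ (it commutes with all $\rho_{G\times Y}(a)$). The projection $\widehat{P}=(F\otimes I)P(F\otimes I)^\ast$ of $L^2(\widehat{G}\times Y)$ onto $\widehat{H}$ decomposes as $\widehat{P}=\int^\oplus_{\widehat{G}}\widehat{P}_\xi\,\mathrm{d}\widehat{\nu}(\xi)$ with respect to $L^2(\widehat{G}\times Y)=\int^\oplus_{\widehat{G}}L^2(Y)\,\mathrm{d}\widehat{\nu}(\xi)$,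 for a (measurable) family $(\widehat{P}_\xi)_{\xi\in\widehat{G}}$ of orthogonal projections in $L^2(Y)$; such a family is fixed. $\widehat{H}_\xi=\widehat{P}_\xi(L^2(Y))$, $d_\xi=\dim(\widehat{H}_\xi)$, $\Omega=\{\xi\in\widehat{G}\colon d_\xi>0\}$. $(\widehat{H}_\xi)_{\xi\in\Omega}$ is a measurable field of Hilbert spaces, with measurable structure given by the fundamental sequence $\xi\mapsto\widehat{P}_\xi e_j$, where $(e_j)_{j\in\mathbb{N}}$ is an orthonormal basis of $L^2(Y)$. In the equality, a function $g\in L^2(\widehat{G}\times Y)$ is identified with the family $(g(\xi,\cdot))_\xi$ and families over $\Omega$ are extended by zero to $\widehat{G}\setminus\Omega$. *)

theory Defs
  imports "HOL-Analysis.Analysis"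
begin

section \<open>Spaces of square-integrable functions\<close>

text \<open>
  Elements of \<open>L\<^sup>2(M)\<close> are represented by square-integrable functions.  Equality in \<open>L\<^sup>2(M)\<close>
  is equality almost everywhere, and all notions below are invariant under it.  The inner product
  is linear in the first argument.
\<close>

definition L2 :: "'a measure \<Rightarrow> ('a \<Rightarrow> complex) set" where
  "L2 M = {f \<in> borel_measurable M. integrable M (\<lambda>x. (cmod (f x))\<^sup>2)}"

definition L2_inner :: "'a measure \<Rightarrow> ('a \<Rightarrow> complex) \<Rightarrow> ('a \<Rightarrow> complex) \<Rightarrow> complex" where
  "L2_inner M f g = (LINT x|M. f x * cnj (g x))"

definition L2_norm :: "'a measure \<Rightarrow> ('a \<Rightarrow> complex) \<Rightarrow> real" where
  "L2_norm M f = sqrt (LINT x|M. (cmod (f x))\<^sup>2)"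

definition L2_separable :: "'a measure \<Rightarrow> bool" where
  "L2_separable M \<longleftrightarrow>
     (\<exists>D. countable D \<and> D \<subseteq> L2 M \<and>
        (\<forall>f\<in>L2 M. \<forall>\<epsilon>>0. \<exists>d\<in>D. L2_norm M (\<lambda>x. f x - d x) < \<epsilon>))"

text \<open>
  The last condition, applied to constant sequences, makes a closed subspace saturated under
  equality almost everywhere.
\<close>

definition L2_closed_subspace :: "'a measure \<Rightarrow> ('a \<Rightarrow> complex) set \<Rightarrow> bool" where
  "L2_closed_subspace M S \<longleftrightarrow>
     S \<subseteq> L2 M \<and> (\<lambda>x. 0) \<in> S \<and>
     (\<forall>f\<in>S. \<forall>g\<in>S. (\<lambda>x. f x + g x) \<in> S) \<and>
     (\<forall>c. \<forall>f\<in>S. (\<lambda>x. c * f x) \<in> S) \<and>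
     (\<forall>s. \<forall>f\<in>L2 M. (\<forall>n. s n \<in> S) \<and>
        (\<lambda>n::nat. L2_norm M (\<lambda>x. s n x - f x)) \<longlonglongrightarrow> 0 \<longrightarrow> f \<in> S)"

definition L2_onb :: "'a measure \<Rightarrow> ('a \<Rightarrow> complex) set \<Rightarrow> ('i \<Rightarrow> 'a \<Rightarrow> complex) \<Rightarrow> 'i set \<Rightarrow> bool" where
  "L2_onb M S e J \<longleftrightarrow>
     (\<forall>j\<in>J. e j \<in> S) \<and>
     (\<forall>i\<in>J. \<forall>j\<in>J. L2_inner M (e i) (e j) = (if i = j then 1 else 0)) \<and>
     (\<forall>f\<in>S. \<forall>\<epsilon>>0. \<exists>I c. finite I \<and> I \<subseteq> J \<and>
        L2_norm M (\<lambda>x. f x - (\<Sum>i\<in>I. c i * e i x)) < \<epsilon>)"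

text \<open>
  Hilbert space dimension, with all infinite cardinalities identified.  Any two orthonormal bases
  have the same cardinality, so the infimum only serves to name the common value.
\<close>

definition L2_dim :: "'a measure \<Rightarrow> ('a \<Rightarrow> complex) set \<Rightarrow> enat" where
  "L2_dim M S = (INF B\<in>{B. L2_onb M S (\<lambda>b. b) B}. if finite B then enat (card B) else \<infinity>)"


section \<open>Operators\<close>

text \<open>
  An operator sends representatives to representatives.  Linearity together with boundedness
  implies that it respects equality almost everywhere.
\<close>

definition L2_operator ::
    "'a measure \<Rightarrow> 'b measure \<Rightarrow> (('a \<Rightarrow> complex) \<Rightarrow> ('b \<Rightarrow> complex)) \<Rightarrow> bool" where
  "L2_operator M N T \<longleftrightarrow>
     (\<forall>f\<in>L2 M. T f \<in> L2 N) \<and>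
     (\<forall>f\<in>L2 M. \<forall>g\<in>L2 M. AE x in N. T (\<lambda>y. f y + g y) x = T f x + T g x) \<and>
     (\<forall>c. \<forall>f\<in>L2 M. AE x in N. T (\<lambda>y. c * f y) x = c * T f x) \<and>
     (\<exists>C. \<forall>f\<in>L2 M. L2_norm N (T f) \<le> C * L2_norm M f)"

definition L2_image ::
    "'b measure \<Rightarrow> (('a \<Rightarrow> complex) \<Rightarrow> ('b \<Rightarrow> complex)) \<Rightarrow> ('a \<Rightarrow> complex) set \<Rightarrow> ('b \<Rightarrow> complex) set" where
  "L2_image N T S = {g \<in> L2 N. \<exists>f\<in>S. AE x in N. g x = T f x}"

definition L2_unitary ::
    "'a measure \<Rightarrow> 'b measure \<Rightarrow> (('a \<Rightarrow> complex) \<Rightarrow> ('b \<Rightarrow> complex)) \<Rightarrow> bool" where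
  "L2_unitary M N T \<longleftrightarrow>
     L2_operator M N T \<and>
     (\<forall>f\<in>L2 M. \<forall>g\<in>L2 M. L2_inner N (T f) (T g) = L2_inner M f g) \<and>
     L2_image N T (L2 M) = L2 N"

definition L2_adjoint ::
    "'a measure \<Rightarrow> 'b measure \<Rightarrow> (('a \<Rightarrow> complex) \<Rightarrow> ('b \<Rightarrow> complex)) \<Rightarrow>
     (('b \<Rightarrow> complex) \<Rightarrow> ('a \<Rightarrow> complex)) \<Rightarrow> bool" where
  "L2_adjoint M N T T' \<longleftrightarrow>
     L2_operator N M T' \<and>
     (\<forall>f\<in>L2 M. \<forall>g\<in>L2 N. L2_inner N (T f) g = L2_inner M f (T' g))"

definition L2_projection :: "'a measure \<Rightarrow> (('a \<Rightarrow> complex) \<Rightarrow> ('a \<Rightarrow> complex)) \<Rightarrow> bool" where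
  "L2_projection M P \<longleftrightarrow>
     L2_operator M M P \<and>
     (\<forall>f\<in>L2 M. AE x in M. P (P f) x = P f x) \<and>
     (\<forall>f\<in>L2 M. \<forall>g\<in>L2 M. L2_inner M (P f) g = L2_inner M f (P g))"

text \<open>
  \<open>V\<close> is the operator \<open>T \<otimes> I\<close> from \<open>L\<^sup>2(M \<times> N)\<close> to \<open>L\<^sup>2(M' \<times> N)\<close>: the bounded operator
  that acts as prescribed on elementary tensors.
\<close>

definition L2_tensor_id ::
    "'a measure \<Rightarrow> 'b measure \<Rightarrow> 'c measure \<Rightarrow> (('a \<Rightarrow> complex) \<Rightarrow> ('b \<Rightarrow> complex)) \<Rightarrow>
     (('a \<times> 'c \<Rightarrow> complex) \<Rightarrow> ('b \<times> 'c \<Rightarrow> complex)) \<Rightarrow> bool" where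
  "L2_tensor_id M M' N T V \<longleftrightarrow>
     L2_operator (M \<Otimes>\<^sub>M N) (M' \<Otimes>\<^sub>M N) V \<and>
     (\<forall>f\<in>L2 M. \<forall>g\<in>L2 N. AE z in M' \<Otimes>\<^sub>M N.
        V (\<lambda>(u, v). f u * g v) z = T f (fst z) * g (snd z))"


section \<open>Direct integrals\<close>

text \<open>
  The operator \<open>T\<close> on \<open>L\<^sup>2(M \<times> N)\<close> is the direct integral of the measurable family \<open>(A \<xi>)\<close> of
  operators on \<open>L\<^sup>2(N)\<close>.  The section \<open>g(\<xi>, \<cdot>)\<close> is in \<open>L\<^sup>2(N)\<close> only for almost every \<open>\<xi>\<close>.
\<close>

definition direct_integral_operator ::
    "'x measure \<Rightarrow> 'y measure \<Rightarrow> ('x \<Rightarrow> ('y \<Rightarrow> complex) \<Rightarrow> ('y \<Rightarrow> complex)) \<Rightarrow>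
     (('x \<times> 'y \<Rightarrow> complex) \<Rightarrow> ('x \<times> 'y \<Rightarrow> complex)) \<Rightarrow> bool" where
  "direct_integral_operator M N A T \<longleftrightarrow>
     (\<forall>f\<in>L2 N. \<forall>g\<in>L2 N. (\<lambda>\<xi>. L2_inner N (A \<xi> f) g) \<in> borel_measurable M) \<and>
     (\<forall>g\<in>L2 (M \<Otimes>\<^sub>M N). AE \<xi> in M. AE y in N. T g (\<xi>, y) = A \<xi> (\<lambda>v. g (\<xi>, v)) y)"

text \<open>
  The direct integral over \<open>M\<close> of the Hilbert spaces \<open>K \<xi> \<subseteq> L\<^sup>2(N)\<close>, whose measurable structure
  is given by the fundamental sequence \<open>(s j)\<close>, \<open>j \<in> J\<close>: its elements are the square-integrable
  vector fields that are measurable with respect to this sequence.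
\<close>

definition direct_integral ::
    "'x measure \<Rightarrow> 'y measure \<Rightarrow> ('x \<Rightarrow> ('y \<Rightarrow> complex) set) \<Rightarrow>
     ('j \<Rightarrow> 'x \<Rightarrow> 'y \<Rightarrow> complex) \<Rightarrow> 'j set \<Rightarrow> ('x \<Rightarrow> 'y \<Rightarrow> complex) set" where
  "direct_integral M N K s J =
     {h. (\<forall>\<xi>\<in>space M. h \<xi> \<in> K \<xi>) \<and>
         (\<forall>j\<in>J. (\<lambda>\<xi>. L2_inner N (h \<xi>) (s j \<xi>)) \<in> borel_measurable M) \<and>
         integrable M (\<lambda>\<xi>. (L2_norm N (h \<xi>))\<^sup>2)}"

definition direct_integral_inner ::
    "'x measure \<Rightarrow> 'y measure \<Rightarrow> ('x \<Rightarrow> 'y \<Rightarrow> complex) \<Rightarrow> ('x \<Rightarrow> 'y \<Rightarrow> complex) \<Rightarrow> complex" where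
  "direct_integral_inner M N h k = (LINT \<xi>|M. L2_inner N (h \<xi>) (k \<xi>))"

text \<open>
  Families \<open>(h \<xi>)\<close> of elements of \<open>L\<^sup>2(N)\<close> are identified when they agree, as elements of
  \<open>L\<^sup>2(N)\<close>, for \<open>M\<close>-almost every \<open>\<xi>\<close>.
\<close>

definition family_eq ::
    "'x measure \<Rightarrow> 'y measure \<Rightarrow> ('x \<Rightarrow> 'y \<Rightarrow> complex) \<Rightarrow> ('x \<Rightarrow> 'y \<Rightarrow> complex) \<Rightarrow> bool" where
  "family_eq M N h k \<longleftrightarrow> (AE \<xi> in M. AE y in N. h \<xi> y = k \<xi> y)"

definition extend_by_zero :: "'x set \<Rightarrow> ('x \<Rightarrow> 'y \<Rightarrow> complex) \<Rightarrow> 'x \<Rightarrow> 'y \<Rightarrow> complex" where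
  "extend_by_zero \<Omega> h \<xi> = (if \<xi> \<in> \<Omega> then h \<xi> else (\<lambda>y. 0))"

text \<open>
  All families representing an element of \<open>A\<close>, for a set \<open>A\<close> of functions on the product, and
  for a set \<open>D\<close> of families over \<open>\<Omega>\<close>, respectively.
\<close>

definition families_of_functions ::
    "'x measure \<Rightarrow> 'y measure \<Rightarrow> ('x \<times> 'y \<Rightarrow> complex) set \<Rightarrow> ('x \<Rightarrow> 'y \<Rightarrow> complex) set" where
  "families_of_functions M N A =
     {h. (\<forall>\<xi>\<in>space M. h \<xi> \<in> L2 N) \<and> (\<exists>g\<in>A. family_eq M N h (curry g))}"

definition families_extended_by_zero ::
    "'x measure \<Rightarrow> 'y measure \<Rightarrow> 'x set \<Rightarrow> ('x \<Rightarrow> 'y \<Rightarrow> complex) set \<Rightarrow> ('x \<Rightarrow> 'y \<Rightarrow> complex) set" where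
  "families_extended_by_zero M N \<Omega> D =
     {h. (\<forall>\<xi>\<in>space M. h \<xi> \<in> L2 N) \<and> (\<exists>k\<in>D. family_eq M N h (extend_by_zero \<Omega> k))}"


section \<open>Haar measure and the dual group\<close>

text \<open>
  Haar measure as a Radon measure on the Borel sets of the topology \<open>X\<close>, for the group operation
  \<open>mul\<close> on \<open>topspace X\<close>.
\<close>

definition haar_measure :: "'a topology \<Rightarrow> ('a \<Rightarrow> 'a \<Rightarrow> 'a) \<Rightarrow> 'a measure \<Rightarrow> bool" where
  "haar_measure X mul \<mu> \<longleftrightarrow>
     space \<mu> = topspace X \<and>
     sets \<mu> = sigma_sets (topspace X) {U. openin X U} \<and>
     emeasure \<mu> (space \<mu>) \<noteq> 0 \<and>
     (\<forall>a\<in>topspace X. \<forall>A\<in>sets \<mu>. emeasure \<mu> (mul a ` A) = emeasure \<mu> A) \<and>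
     (\<forall>K. compactin X K \<longrightarrow> emeasure \<mu> K < \<infinity>) \<and>
     (\<forall>A\<in>sets \<mu>. emeasure \<mu> A = (INF U\<in>{U. openin X U \<and> A \<subseteq> U}. emeasure \<mu> U)) \<and>
     (\<forall>U. openin X U \<longrightarrow> emeasure \<mu> U = (SUP K\<in>{K. compactin X K \<and> K \<subseteq> U}. emeasure \<mu> K))"

definition sigma_compact :: "'a::topological_space set \<Rightarrow> bool" where
  "sigma_compact S \<longleftrightarrow> (\<exists>K::nat \<Rightarrow> 'a set. (\<forall>n. compact (K n)) \<and> (\<Union>n. K n) = S)"

definition dual_group :: "('g::topological_ab_group_add \<Rightarrow> complex) set" where
  "dual_group = {\<xi>. continuous_on UNIV \<xi> \<and> (\<forall>x. cmod (\<xi> x) = 1) \<and>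
                    (\<forall>x y. \<xi> (x + y) = \<xi> x * \<xi> y)}"

text \<open>The compact-open topology.\<close>

definition dual_topology :: "('g::topological_ab_group_add \<Rightarrow> complex) topology" where
  "dual_topology =
     topology_generated_by {{\<xi>\<in>dual_group. \<xi> ` K \<subseteq> U} | K U. compact K \<and> open U}"

definition fourier_L1 :: "'g measure \<Rightarrow> ('g \<Rightarrow> complex) \<Rightarrow> ('g \<Rightarrow> complex) \<Rightarrow> complex" where
  "fourier_L1 \<nu> f \<xi> = (LINT x|\<nu>. cnj (\<xi> x) * f x)"

text \<open>
  The dual Haar measure is the Haar measure on the dual group normalised so that the Fourier
  transform is isometric for the \<open>L\<^sup>2\<close>-norms.
\<close>

definition dual_haar_measure ::
    "'g::topological_ab_group_add measure \<Rightarrow> ('g \<Rightarrow> complex) measure \<Rightarrow> bool" where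
  "dual_haar_measure \<nu> \<nu>' \<longleftrightarrow>
     haar_measure dual_topology (\<lambda>\<xi> \<eta> x. \<xi> x * \<eta> x) \<nu>' \<and>
     (\<forall>f\<in>L2 \<nu>. integrable \<nu> f \<longrightarrow>
        fourier_L1 \<nu> f \<in> L2 \<nu>' \<and> L2_norm \<nu>' (fourier_L1 \<nu> f) = L2_norm \<nu> f)"

definition fourier_L2 ::
    "'g::topological_ab_group_add measure \<Rightarrow> ('g \<Rightarrow> complex) measure \<Rightarrow>
     (('g \<Rightarrow> complex) \<Rightarrow> (('g \<Rightarrow> complex) \<Rightarrow> complex)) \<Rightarrow> bool" where
  "fourier_L2 \<nu> \<nu>' F \<longleftrightarrow>
     L2_unitary \<nu> \<nu>' F \<and>
     (\<forall>f\<in>L2 \<nu>. integrable \<nu> f \<longrightarrow> (AE \<xi> in \<nu>'. F f \<xi> = fourier_L1 \<nu> f \<xi>))"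

end

theory Submission
  imports Defs
begin

text \<open>
  Since \<open>F \<otimes> I\<close> is isometric, \<open>H_hat\<close> is the set of fixed points of \<open>(F \<otimes> I) P (F \<otimes> I)\<^sup>\<star>\<close>.
  This operator acts fibrewise by \<open>P_hat \<xi>\<close>, so \<open>g\<close> is in \<open>H_hat\<close> iff \<open>g(\<xi>, \<cdot>)\<close> is in \<open>H_fib \<xi>\<close> for
  almost every \<open>\<xi>\<close>.  Both directions then are measurability statements: the sections of a function
  in \<open>L\<^sup>2\<close> of the product have measurable coefficients, and conversely a square-integrable field with
  measurable coefficients has a jointly measurable representative, obtained from its expansions
  in the basis.
\<close>

section \<open>Square-integrable functions\<close>

text \<open>Operators act on functions, not on classes, and the null sets shape the argument. A
  function in L2 of the product has sections in L2, and for \<open>H_hat\<close> in the fibre, only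
  for almost every \<xi>, whereas an element of the direct integral must lie in the fibre for every
  \<xi>. Setting the bad sections to 0 and then applying \<open>P_hat \<xi>\<close> repairs this,
  and for a fixed point it changes nothing almost everywhere. The fundamental sequence
  \<open>P_hat \<xi> (e j)\<close> varies with \<xi> and need not be orthonormal; but for fields
  with values in the fibres, self-adjointness of \<open>P_hat \<xi>\<close> gives the same
  coefficients as the constant basis \<open>e j\<close>, so that Parseval applies. Finally,
  \<open>F \<otimes> I\<close> is prescribed only on elementary tensors, and its isometry is
  extended from them by the totality of rectangles of finite measure.\<close>

lemma L2_measurable [measurable_dest]: "f \<in> L2 M \<Longrightarrow> f \<in> borel_measurable M"
  by (simp add: L2_def)

lemma L2_integrable_square: "f \<in> L2 M \<Longrightarrow> integrable M (\<lambda>x. (cmod (f x))\<^sup>2)"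
  by (simp add: L2_def)

lemma L2_iff_nn_integral:
  "f \<in> L2 M \<longleftrightarrow> f \<in> borel_measurable M \<and> (\<integral>\<^sup>+x. ennreal ((cmod (f x))\<^sup>2) \<partial>M) < \<infinity>"
  by (auto simp: L2_def integrable_iff_bounded)

lemma L2_integrable_mult_cmod:
  assumes "f \<in> L2 M" "g \<in> L2 M"
  shows "integrable M (\<lambda>x. cmod (f x) * cmod (g x))"
proof (rule Bochner_Integration.integrable_bound)
  show "integrable M (\<lambda>x. (cmod (f x))\<^sup>2 + (cmod (g x))\<^sup>2)"
    using assms by (intro Bochner_Integration.integrable_add L2_integrable_square)
  show "(\<lambda>x. cmod (f x) * cmod (g x)) \<in> borel_measurable M"
    using assms[THEN L2_measurable] by measurable
  have "a * b \<le> a\<^sup>2 + b\<^sup>2" if "a \<ge> 0" "b \<ge> 0" for a b :: real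
    using sum_squares_bound[of a b] mult_nonneg_nonneg[OF that] by simp
  then show "AE x in M. norm (cmod (f x) * cmod (g x)) \<le> norm ((cmod (f x))\<^sup>2 + (cmod (g x))\<^sup>2)"
    by (intro AE_I2) (simp add: abs_mult)
qed

lemma L2_integrable_mult_cnj:
  assumes "f \<in> L2 M" "g \<in> L2 M"
  shows "integrable M (\<lambda>x. f x * cnj (g x))"
proof (rule Bochner_Integration.integrable_bound[OF L2_integrable_mult_cmod[OF assms]])
  have [measurable]: "cnj \<in> borel_measurable borel"
    by (intro borel_measurable_continuous_onI continuous_intros)
  show "(\<lambda>x. f x * cnj (g x)) \<in> borel_measurable M"
    using assms[THEN L2_measurable] by measurable
qed (auto simp: norm_mult)

lemma L2_zero [simp]: "(\<lambda>x. 0) \<in> L2 M"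
  by (simp add: L2_def)

lemma L2_scale:
  assumes "f \<in> L2 M"
  shows "(\<lambda>x. c * f x) \<in> L2 M"
  using assms unfolding L2_def by (auto simp: norm_mult power_mult_distrib)

lemma L2_add:
  assumes "f \<in> L2 M" "g \<in> L2 M"
  shows "(\<lambda>x. f x + g x) \<in> L2 M"
  unfolding L2_def
proof (intro CollectI conjI)
  show meas: "(\<lambda>x. f x + g x) \<in> borel_measurable M"
    using assms[THEN L2_measurable] by measurable
  show "integrable M (\<lambda>x. (cmod (f x + g x))\<^sup>2)"
  proof (rule Bochner_Integration.integrable_bound)
    show "integrable M (\<lambda>x. 2 * (cmod (f x))\<^sup>2 + 2 * (cmod (g x))\<^sup>2)"
      using assms by (intro Bochner_Integration.integrable_add integrable_mult_right L2_integrable_square)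
    show "(\<lambda>x. (cmod (f x + g x))\<^sup>2) \<in> borel_measurable M"
      using meas by measurable
    have "(cmod (a + b))\<^sup>2 \<le> 2 * (cmod a)\<^sup>2 + 2 * (cmod b)\<^sup>2" for a b
    proof -
      have "(cmod (a + b))\<^sup>2 \<le> (cmod a + cmod b)\<^sup>2"
        by (intro power_mono norm_triangle_ineq) auto
      then show ?thesis
        using sum_squares_bound[of "cmod a" "cmod b"] by (simp add: power2_sum)
    qed
    then show "AE x in M. norm ((cmod (f x + g x))\<^sup>2) \<le> norm (2 * (cmod (f x))\<^sup>2 + 2 * (cmod (g x))\<^sup>2)"
      by (intro AE_I2) simp
  qed
qed

lemma L2_diff:
  assumes "f \<in> L2 M" "g \<in> L2 M"
  shows "(\<lambda>x. f x - g x) \<in> L2 M"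
  using L2_add[OF assms(1) L2_scale[OF assms(2), of "-1"]] by simp

lemma L2_sum:
  assumes "\<And>i. i \<in> I \<Longrightarrow> f i \<in> L2 M"
  shows "(\<lambda>x. \<Sum>i\<in>I. f i x) \<in> L2 M"
  using assms by (induction I rule: infinite_finite_induct) (auto intro: L2_add)

lemma L2_inner_add_left:
  assumes "f \<in> L2 M" "g \<in> L2 M" "h \<in> L2 M"
  shows "L2_inner M (\<lambda>x. f x + g x) h = L2_inner M f h + L2_inner M g h"
  unfolding L2_inner_def
  by (subst Bochner_Integration.integral_add[symmetric])
    (auto intro!: L2_integrable_mult_cnj assms simp: algebra_simps)

lemma L2_inner_scale_left: "L2_inner M (\<lambda>x. c * f x) h = c * L2_inner M f h"
  unfolding L2_inner_def by (simp add: mult.assoc)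

lemma L2_inner_commute: "L2_inner M g f = cnj (L2_inner M f g)"
  using Bochner_Integration.integral_cnj[of M "\<lambda>x. f x * cnj (g x)"] by (simp add: L2_inner_def mult.commute)

lemma L2_inner_diff_left:
  assumes "f \<in> L2 M" "g \<in> L2 M" "h \<in> L2 M"
  shows "L2_inner M (\<lambda>x. f x - g x) h = L2_inner M f h - L2_inner M g h"
  using L2_inner_add_left[OF assms(1) L2_scale[OF assms(2), of "-1"] assms(3)]
  by (simp only: L2_inner_scale_left) simp

lemma L2_inner_diff_right:
  assumes "f \<in> L2 M" "g \<in> L2 M" "h \<in> L2 M"
  shows "L2_inner M h (\<lambda>x. f x - g x) = L2_inner M h f - L2_inner M h g"
  by (subst (1 2 3) L2_inner_commute) (simp add: L2_inner_diff_left assms)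

lemma L2_inner_scale_right: "L2_inner M f (\<lambda>x. c * h x) = cnj c * L2_inner M f h"
  by (subst (1 2) L2_inner_commute) (simp add: L2_inner_scale_left)

lemma L2_inner_sum_left:
  assumes "\<And>i. i \<in> I \<Longrightarrow> f i \<in> L2 M" "h \<in> L2 M"
  shows "L2_inner M (\<lambda>x. \<Sum>i\<in>I. f i x) h = (\<Sum>i\<in>I. L2_inner M (f i) h)"
  using assms
proof (induction I rule: infinite_finite_induct)
  case (insert i I)
  then show ?case
    by (simp add: L2_inner_add_left L2_sum)
qed (auto simp: L2_inner_def)

lemma L2_inner_sum_right:
  assumes "\<And>i. i \<in> I \<Longrightarrow> f i \<in> L2 M" "h \<in> L2 M"
  shows "L2_inner M h (\<lambda>x. \<Sum>i\<in>I. f i x) = (\<Sum>i\<in>I. L2_inner M h (f i))"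
  by (subst (1 2) L2_inner_commute) (simp add: L2_inner_sum_left assms)

text \<open>The measure need not be complete, so a function equal almost everywhere to one in L2 may
  fail to be measurable; hence all four memberships are assumed.\<close>

lemma L2_inner_cong_AE:
  assumes "AE x in M. f x = f' x" "AE x in M. g x = g' x"
    and "f \<in> L2 M" "g \<in> L2 M" "f' \<in> L2 M" "g' \<in> L2 M"
  shows "L2_inner M f g = L2_inner M f' g'"
  unfolding L2_inner_def
  using assms by (intro integral_cong_AE borel_measurable_integrable L2_integrable_mult_cnj) auto

lemma L2_norm_nonneg [simp]: "L2_norm M f \<ge> 0"
  by (simp add: L2_norm_def)

lemma L2_norm_square: "(L2_norm M f)\<^sup>2 = (LINT x|M. (cmod (f x))\<^sup>2)"
  by (simp add: L2_norm_def)

lemma L2_inner_self: "L2_inner M f f = complex_of_real ((L2_norm M f)\<^sup>2)"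
  unfolding L2_inner_def L2_norm_square
  by (simp add: complex_norm_square[symmetric] del: of_real_power)

lemma nn_integral_cmod_square:
  assumes "f \<in> L2 M"
  shows "(\<integral>\<^sup>+x. ennreal ((cmod (f x))\<^sup>2) \<partial>M) = ennreal ((L2_norm M f)\<^sup>2)"
  unfolding L2_norm_square by (intro nn_integral_eq_integral L2_integrable_square assms) auto

lemma L2_norm_eq_0_iff:
  assumes "f \<in> L2 M"
  shows "L2_norm M f = 0 \<longleftrightarrow> (AE x in M. f x = 0)"
proof -
  have "L2_norm M f = 0 \<longleftrightarrow> (LINT x|M. (cmod (f x))\<^sup>2) = 0"
    by (simp add: L2_norm_def)
  also have "\<dots> \<longleftrightarrow> (AE x in M. (cmod (f x))\<^sup>2 = 0)"
    by (intro integral_nonneg_eq_0_iff_AE L2_integrable_square assms) auto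
  finally show ?thesis by simp
qed

lemma L2_norm_scale: "(L2_norm M (\<lambda>x. c * f x))\<^sup>2 = (cmod c)\<^sup>2 * (L2_norm M f)\<^sup>2"
  by (simp add: L2_norm_square norm_mult power_mult_distrib)

lemma L2_norm_diff_square:
  assumes "f \<in> L2 M" "g \<in> L2 M"
  shows "(L2_norm M (\<lambda>x. f x - g x))\<^sup>2 = (L2_norm M f)\<^sup>2 - 2 * Re (L2_inner M f g) + (L2_norm M g)\<^sup>2"
proof -
  have "L2_inner M (\<lambda>x. f x - g x) (\<lambda>x. f x - g x) =
      L2_inner M f f - L2_inner M f g - cnj (L2_inner M f g) + L2_inner M g g"
    using assms L2_inner_commute[of M g f]
    by (simp add: L2_inner_diff_left L2_inner_diff_right L2_diff)
  then have "Re (L2_inner M (\<lambda>x. f x - g x) (\<lambda>x. f x - g x)) =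
      Re (L2_inner M f f) - 2 * Re (L2_inner M f g) + Re (L2_inner M g g)"
    by simp
  then show ?thesis
    by (simp add: L2_inner_self del: of_real_power)
qed

lemma L2_Cauchy_Schwarz:
  assumes "f \<in> L2 M" "g \<in> L2 M"
  shows "cmod (L2_inner M f g) \<le> L2_norm M f * L2_norm M g"
proof (cases "L2_norm M g = 0")
  case True
  then have "AE x in M. g x = 0"
    using L2_norm_eq_0_iff assms by blast
  then have "L2_inner M f g = L2_inner M f (\<lambda>x. 0)"
    using assms by (intro L2_inner_cong_AE) auto
  then show ?thesis by (simp add: L2_inner_def)
next
  case False
  \<comment> \<open>\<open>c\<close> makes \<open>c * g\<close> the orthogonal projection of
    \<open>f\<close> onto the span of \<open>g\<close>; nonnegativity of the squared norm of the
    remainder is then the claim.\<close>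
  define a c where "a = L2_inner M f g" and "c = a / complex_of_real ((L2_norm M g)\<^sup>2)"
  define n where "n = (L2_norm M g)\<^sup>2"
  have n: "n > 0" using False by (simp add: n_def)
  have "cnj c * a = of_real ((cmod a)\<^sup>2 / n)"
    using n by (simp add: c_def n_def[symmetric] complex_norm_square mult.commute del: of_real_power)
  then have "Re (L2_inner M f (\<lambda>x. c * g x)) = (cmod a)\<^sup>2 / n"
    by (simp add: L2_inner_scale_right a_def[symmetric] del: of_real_power of_real_divide)
  moreover have "(L2_norm M (\<lambda>x. c * g x))\<^sup>2 = (cmod a)\<^sup>2 / n"
  proof -
    have "cmod c = cmod a / n"
      using n by (simp add: c_def n_def[symmetric] norm_divide del: of_real_power)
    then show ?thesis
      using n unfolding L2_norm_scale n_def[symmetric] by (simp add: power_divide power2_eq_square)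
  qed
  ultimately have "0 \<le> (L2_norm M f)\<^sup>2 - (cmod a)\<^sup>2 / n"
    using L2_norm_diff_square[OF assms(1) L2_scale[OF assms(2)], of c]
      zero_le_power2[of "L2_norm M (\<lambda>x. f x - c * g x)"] by linarith
  then have "(cmod a)\<^sup>2 \<le> (L2_norm M f * L2_norm M g)\<^sup>2"
    using n by (simp add: field_simps n_def power_mult_distrib)
  then show ?thesis
    unfolding a_def by (rule power2_le_imp_le) simp
qed


section \<open>Orthonormal bases\<close>

lemma L2_onbD:
  assumes "L2_onb M S e J"
  shows "j \<in> J \<Longrightarrow> e j \<in> S"
    and "i \<in> J \<Longrightarrow> j \<in> J \<Longrightarrow> L2_inner M (e i) (e j) = (if i = j then 1 else 0)"
    and "f \<in> S \<Longrightarrow> \<epsilon> > 0 \<Longrightarrow>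
      \<exists>I c. finite I \<and> I \<subseteq> J \<and> L2_norm M (\<lambda>x. f x - (\<Sum>i\<in>I. c i * e i x)) < \<epsilon>"
  using assms unfolding L2_onb_def by blast+

text \<open>Completing the square in each coefficient. The last sum vanishes exactly at the Fourier
  coefficients, so they give the best approximation with index set \<open>I\<close>, and
  nonnegativity of the left side at them is Bessel's inequality.\<close>

lemma L2_norm_diff_linear_combination:
  assumes "L2_onb M (L2 M) e J" "f \<in> L2 M" "finite I" "I \<subseteq> J"
  shows "(L2_norm M (\<lambda>x. f x - (\<Sum>i\<in>I. c i * e i x)))\<^sup>2 =
    (L2_norm M f)\<^sup>2 - (\<Sum>i\<in>I. (cmod (L2_inner M f (e i)))\<^sup>2) + (\<Sum>i\<in>I. (cmod (L2_inner M f (e i) - c i))\<^sup>2)"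
proof -
  let ?s = "\<lambda>x. \<Sum>i\<in>I. c i * e i x"
  note onb = L2_onbD[OF assms(1)]
  have e: "(\<lambda>x. c i * e i x) \<in> L2 M" if "i \<in> I" for i
    using that assms(4) onb(1) by (auto intro: L2_scale)
  have s: "?s \<in> L2 M"
    using e by (rule L2_sum)
  have fs: "L2_inner M f ?s = (\<Sum>i\<in>I. cnj (c i) * L2_inner M f (e i))"
    using e assms(2) by (simp add: L2_inner_sum_right L2_inner_scale_right)
  have "L2_inner M ?s ?s = (\<Sum>i\<in>I. \<Sum>j\<in>I. c i * cnj (c j) * L2_inner M (e i) (e j))"
  proof -
    have "L2_inner M ?s ?s = (\<Sum>i\<in>I. L2_inner M (\<lambda>x. c i * e i x) ?s)"
      using e s by (rule L2_inner_sum_left)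
    also have "\<dots> = (\<Sum>i\<in>I. \<Sum>j\<in>I. c i * cnj (c j) * L2_inner M (e i) (e j))"
      using e by (intro sum.cong refl)
        (simp add: L2_inner_sum_right L2_inner_scale_right L2_inner_scale_left sum_distrib_left
          mult_ac L2_onbD(1)[OF assms(1)] subsetD[OF assms(4)])
    finally show ?thesis .
  qed
  also have "\<dots> = (\<Sum>i\<in>I. \<Sum>j\<in>I. if j = i then c i * cnj (c i) else 0)"
    using assms(4) by (intro sum.cong refl) (auto simp: onb(2) subset_iff)
  also have "\<dots> = (\<Sum>i\<in>I. of_real ((cmod (c i))\<^sup>2))"
    using assms(3) by (simp add: complex_norm_square del: of_real_power)
  finally have ss: "(L2_norm M ?s)\<^sup>2 = (\<Sum>i\<in>I. (cmod (c i))\<^sup>2)"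
    unfolding L2_inner_self of_real_sum[symmetric] of_real_eq_iff .
  have "(cmod (a - b))\<^sup>2 = (cmod a)\<^sup>2 - 2 * Re (cnj b * a) + (cmod b)\<^sup>2" for a b
    unfolding cmod_power2 by (simp add: power2_eq_square algebra_simps)
  then show ?thesis
    using L2_norm_diff_square[OF assms(2) s]
    by (simp add: fs ss Re_sum sum.distrib sum_subtractf sum_distrib_left)
qed

text \<open>\<open>J\<close> may be finite or infinite; cutting it by an initial segment of the
  naturals writes the expansion as one limit in \<open>n\<close> in both cases.\<close>

definition partial_expansion ::
    "'a measure \<Rightarrow> (nat \<Rightarrow> 'a \<Rightarrow> complex) \<Rightarrow> nat set \<Rightarrow> ('a \<Rightarrow> complex) \<Rightarrow> nat \<Rightarrow> 'a \<Rightarrow> complex" where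
  "partial_expansion M e J f n x = (\<Sum>j\<in>J \<inter> {..<n}. L2_inner M f (e j) * e j x)"

lemma partial_expansion_L2:
  assumes "L2_onb M (L2 M) e J"
  shows "partial_expansion M e J f n \<in> L2 M"
  unfolding partial_expansion_def[abs_def]
  using L2_onbD(1)[OF assms] by (intro L2_sum L2_scale) auto

lemma L2_norm_diff_partial_expansion:
  assumes "L2_onb M (L2 M) e J" "f \<in> L2 M"
  shows "(L2_norm M (\<lambda>x. f x - partial_expansion M e J f n x))\<^sup>2 =
    (L2_norm M f)\<^sup>2 - (\<Sum>j\<in>J \<inter> {..<n}. (cmod (L2_inner M f (e j)))\<^sup>2)"
  unfolding partial_expansion_def using assms by (subst L2_norm_diff_linear_combination) auto

lemma Parseval_norm:
  assumes "L2_onb M (L2 M) e J" "f \<in> L2 M"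
  shows "(\<lambda>n. \<Sum>j\<in>J \<inter> {..<n}. (cmod (L2_inner M f (e j)))\<^sup>2) \<longlonglongrightarrow> (L2_norm M f)\<^sup>2"
proof (rule LIMSEQ_I)
  fix r :: real assume r: "r > 0"
  let ?a = "\<lambda>j. (cmod (L2_inner M f (e j)))\<^sup>2"
  \<comment> \<open>The basis property gives a finite combination close to \<open>f\<close> with
    unknown coefficients; the radius is \<open>sqrt r\<close> because the error is squared below.
    Dropping the nonnegative last sum passes from these coefficients to the Fourier
    coefficients.\<close>
  obtain I c where I: "finite I" "I \<subseteq> J"
    and lt: "L2_norm M (\<lambda>x. f x - (\<Sum>i\<in>I. c i * e i x)) < sqrt r"
    using L2_onbD(3)[OF assms(1) assms(2), of "sqrt r"] r by auto
  have "(L2_norm M (\<lambda>x. f x - (\<Sum>i\<in>I. c i * e i x)))\<^sup>2 < (sqrt r)\<^sup>2"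
    using lt by (intro power_strict_mono) auto
  then have "(L2_norm M f)\<^sup>2 - sum ?a I + (\<Sum>i\<in>I. (cmod (L2_inner M f (e i) - c i))\<^sup>2) < r"
    using r by (simp add: L2_norm_diff_linear_combination[OF assms I])
  then have *: "(L2_norm M f)\<^sup>2 - sum ?a I < r"
    using sum_nonneg[of I "\<lambda>i. (cmod (L2_inner M f (e i) - c i))\<^sup>2"] by auto
  obtain N where N: "I \<subseteq> {..<N}"
    using I(1) finite_nat_iff_bounded by blast
  show "\<exists>N. \<forall>n\<ge>N. norm (sum ?a (J \<inter> {..<n}) - (L2_norm M f)\<^sup>2) < r"
  proof (intro exI allI impI)
    fix n assume n: "n \<ge> N"
    have "sum ?a I \<le> sum ?a (J \<inter> {..<n})"
      using I(2) N n by (intro sum_mono2) auto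
    moreover have "sum ?a (J \<inter> {..<n}) \<le> (L2_norm M f)\<^sup>2"
      using L2_norm_diff_partial_expansion[OF assms, of n]
        zero_le_power2[of "L2_norm M (\<lambda>x. f x - partial_expansion M e J f n x)"] by linarith
    ultimately show "norm (sum ?a (J \<inter> {..<n}) - (L2_norm M f)\<^sup>2) < r"
      using * by auto
  qed
qed

lemma partial_expansion_tendsto:
  assumes "L2_onb M (L2 M) e J" "f \<in> L2 M"
  shows "(\<lambda>n. L2_norm M (\<lambda>x. f x - partial_expansion M e J f n x)) \<longlonglongrightarrow> 0"
proof -
  have "(\<lambda>n. (L2_norm M (\<lambda>x. f x - partial_expansion M e J f n x))\<^sup>2) \<longlonglongrightarrow> (L2_norm M f)\<^sup>2 - (L2_norm M f)\<^sup>2"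
    unfolding L2_norm_diff_partial_expansion[OF assms]
    by (intro tendsto_intros Parseval_norm assms)
  from tendsto_real_sqrt[OF this] show ?thesis by simp
qed

text \<open>Continuity of the inner product in its first argument, by Cauchy-Schwarz applied to the
  remainder of the expansion of \<open>f\<close>.\<close>

lemma Parseval_inner:
  assumes "L2_onb M (L2 M) e J" "f \<in> L2 M" "g \<in> L2 M"
  shows "(\<lambda>n. \<Sum>j\<in>J \<inter> {..<n}. L2_inner M f (e j) * L2_inner M (e j) g) \<longlonglongrightarrow> L2_inner M f g"
proof -
  note pe = partial_expansion_L2[OF assms(1)]
  have eq: "L2_inner M (partial_expansion M e J f n) g =
      (\<Sum>j\<in>J \<inter> {..<n}. L2_inner M f (e j) * L2_inner M (e j) g)" for n
    unfolding partial_expansion_def[abs_def] using L2_onbD(1)[OF assms(1)] assms(3)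
    by (subst L2_inner_sum_left) (auto intro: L2_scale simp: L2_inner_scale_left)
  have "(\<lambda>n. L2_norm M (\<lambda>x. f x - partial_expansion M e J f n x) * L2_norm M g) \<longlonglongrightarrow> 0"
    using tendsto_mult_right[OF partial_expansion_tendsto[OF assms(1,2)], of "L2_norm M g"] by simp
  then have "(\<lambda>n. L2_inner M f g - L2_inner M (partial_expansion M e J f n) g) \<longlonglongrightarrow> 0"
    by (rule tendsto_0_le[where K = 1])
      (auto simp: L2_inner_diff_left[symmetric] assms pe L2_diff intro!: always_eventually L2_Cauchy_Schwarz)
  then show ?thesis
    unfolding eq using tendsto_diff[OF tendsto_const[of "L2_inner M f g"]] by fastforce
qed


section \<open>Operators on square-integrable functions\<close>

lemma L2_operator_L2: "L2_operator M N T \<Longrightarrow> f \<in> L2 M \<Longrightarrow> T f \<in> L2 N"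
  by (simp add: L2_operator_def)

lemma L2_operator_cong_AE:
  assumes T: "L2_operator M N T" and f: "f \<in> L2 M" and g: "g \<in> L2 M" and eq: "AE x in M. f x = g x"
  shows "AE x in N. T f x = T g x"
proof -
  let ?d = "\<lambda>x. f x - g x"
  have d: "?d \<in> L2 M" using f g by (rule L2_diff)
  obtain C where "L2_norm N (T ?d) \<le> C * L2_norm M ?d"
    using T d unfolding L2_operator_def by blast
  moreover have "L2_norm M ?d = 0"
    using L2_norm_eq_0_iff[OF d] eq by auto
  ultimately have "L2_norm N (T ?d) = 0"
    using L2_norm_nonneg[of N "T ?d"] by simp
  then have 0: "AE x in N. T ?d x = 0"
    using L2_norm_eq_0_iff L2_operator_L2[OF T d] by blast
  \<comment> \<open>Additivity is applied to \<open>f - g\<close> and \<open>g\<close>, whose sum is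
    \<open>f\<close> pointwise; by boundedness the first summand has a null image.\<close>
  have "\<forall>f\<in>L2 M. \<forall>g\<in>L2 M. AE x in N. T (\<lambda>y. f y + g y) x = T f x + T g x"
    using T unfolding L2_operator_def by blast
  from bspec[OF bspec[OF this d] g]
  have "AE x in N. T (\<lambda>y. ?d y + g y) x = T ?d x + T g x" .
  with 0 show ?thesis by auto
qed

lemma L2_projectionD:
  assumes "L2_projection M P"
  shows "L2_operator M M P"
    and "f \<in> L2 M \<Longrightarrow> P f \<in> L2 M"
    and "f \<in> L2 M \<Longrightarrow> AE x in M. P (P f) x = P f x"
    and "f \<in> L2 M \<Longrightarrow> g \<in> L2 M \<Longrightarrow> L2_inner M (P f) g = L2_inner M f (P g)"
  using assms unfolding L2_projection_def L2_operator_def by blast+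

text \<open>Trades the existential in the image for an equation, which can be carried through
  \<open>F \<otimes> I\<close> and tested fibre by fibre.\<close>

lemma L2_image_projection_iff:
  assumes "L2_projection M P"
  shows "f \<in> L2_image M P (L2 M) \<longleftrightarrow> f \<in> L2 M \<and> (AE x in M. P f x = f x)"
proof
  assume "f \<in> L2_image M P (L2 M)"
  then obtain f0 where f: "f \<in> L2 M" and f0: "f0 \<in> L2 M" and eq: "AE x in M. f x = P f0 x"
    unfolding L2_image_def by blast
  have "AE x in M. P f x = P (P f0) x"
    by (rule L2_operator_cong_AE[OF L2_projectionD(1)[OF assms] f L2_projectionD(2)[OF assms f0] eq])
  then have "AE x in M. P f x = f x"
    using L2_projectionD(3)[OF assms f0] eq by eventually_elim simp
  with f show "f \<in> L2 M \<and> (AE x in M. P f x = f x)" ..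
next
  assume "f \<in> L2 M \<and> (AE x in M. P f x = f x)"
  then have "f \<in> L2 M" "AE x in M. f x = P f x"
    by (auto elim: AE_mp)
  then show "f \<in> L2_image M P (L2 M)"
    unfolding L2_image_def by blast
qed

text \<open>\<open>L2_operator\<close> gives only some bound. Self-adjointness and idempotence
  sharpen it to 1, because the squared norm of \<open>P f\<close> is the inner product of
  \<open>P f\<close> with \<open>f\<close>; in a family of projections the bound is then
  uniform.\<close>

lemma L2_projection_norm_le:
  assumes "L2_projection M P" "f \<in> L2 M"
  shows "L2_norm M (P f) \<le> L2_norm M f"
proof -
  note P = L2_projectionD[OF assms(1)]
  have "L2_inner M (P f) (P f) = L2_inner M (P (P f)) f"
    using P assms(2) by simp
  also have "\<dots> = L2_inner M (P f) f"
    using P assms(2) by (intro L2_inner_cong_AE) auto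
  finally have "(L2_norm M (P f))\<^sup>2 = cmod (L2_inner M (P f) f)"
    by (metis L2_inner_self norm_of_real abs_of_nonneg zero_le_power2)
  also have "\<dots> \<le> L2_norm M (P f) * L2_norm M f"
    using P assms(2) by (intro L2_Cauchy_Schwarz) auto
  finally have "L2_norm M (P f) * L2_norm M (P f) \<le> L2_norm M (P f) * L2_norm M f"
    by (simp add: power2_eq_square)
  then show ?thesis
    using L2_norm_nonneg[of M "P f"] L2_norm_nonneg[of M f] mult_le_cancel_left by (cases "L2_norm M (P f) = 0") auto
qed


section \<open>Product measures with one sigma-finite factor\<close>

text \<open>
  The library proves Fubini's theorem when both factors are sigma-finite.  Integrating over the
  sigma-finite factor first, nothing is needed about the other one, so that no topological
  argument is needed for the dual Haar measure.
\<close>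

lemma AE_pair_sections:
  assumes "sigma_finite_measure N" "AE z in M \<Otimes>\<^sub>M N. Q z"
  shows "AE x in M. AE y in N. Q (x, y)"
proof -
  interpret sigma_finite_measure N by fact
  obtain S where S: "S \<in> sets (M \<Otimes>\<^sub>M N)" "emeasure (M \<Otimes>\<^sub>M N) S = 0"
      "{z \<in> space (M \<Otimes>\<^sub>M N). \<not> Q z} \<subseteq> S"
    using assms(2) unfolding eventually_ae_filter by auto
  have "AE x in M. emeasure N (Pair x -` S) = 0"
    using S emeasure_pair_measure_alt[OF S(1)]
    by (subst nn_integral_0_iff_AE[symmetric]) (auto intro: measurable_emeasure_Pair)
  then show ?thesis
    using AE_space
  proof eventually_elim
    case (elim x)
    moreover have "Pair x -` S \<in> sets N"
      using S(1) by (rule sets_Pair1)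
    ultimately show "AE y in N. Q (x, y)"
      using S(3) by (intro AE_I[where N = "Pair x -` S"]) (auto simp: space_pair_measure)
  qed
qed

text \<open>Measurability of the set where \<open>Q\<close> holds is a genuine hypothesis: the
  product measure is the integral of the measures of the sections only for measurable sets.\<close>

lemma AE_pair_if_sections:
  assumes "sigma_finite_measure N" "{z \<in> space (M \<Otimes>\<^sub>M N). Q z} \<in> sets (M \<Otimes>\<^sub>M N)"
    and "AE x in M. AE y in N. Q (x, y)"
  shows "AE z in M \<Otimes>\<^sub>M N. Q z"
proof -
  interpret sigma_finite_measure N by fact
  let ?S = "{z \<in> space (M \<Otimes>\<^sub>M N). \<not> Q z}"
  have S: "?S \<in> sets (M \<Otimes>\<^sub>M N)"
    using assms(2) by (rule sets.sets_Collect_neg)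
  have "AE x in M. emeasure N (Pair x -` ?S) = 0"
    using assms(3) AE_space
  proof eventually_elim
    case (elim x)
    have eq: "Pair x -` ?S = {y \<in> space N. \<not> Q (x, y)}"
      using elim by (auto simp: space_pair_measure)
    have "{y \<in> space N. \<not> Q (x, y)} \<in> sets N"
      using sets_Pair1[OF S, of x] eq by simp
    then show ?case
      using elim unfolding eq by (subst AE_iff_measurable[symmetric]) auto
  qed
  then have "emeasure (M \<Otimes>\<^sub>M N) ?S = 0"
    unfolding emeasure_pair_measure_alt[OF S]
    using measurable_emeasure_Pair[OF S] by (subst nn_integral_0_iff_AE) auto
  then show ?thesis
    using S by (intro AE_I[where N = ?S]) auto
qed

text \<open>Tonelli with the inner integral over \<open>N\<close>: finiteness of the iterated
  integral makes almost every section integrable, and for those sections the extended and the real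
  integral agree.\<close>

lemma Fubini_nonneg:
  fixes f :: "'a \<times> 'b \<Rightarrow> real"
  assumes "sigma_finite_measure N" "integrable (M \<Otimes>\<^sub>M N) f" "\<And>z. f z \<ge> 0"
  shows "AE x in M. integrable N (\<lambda>y. f (x, y))"
    and "integrable M (\<lambda>x. LINT y|N. f (x, y))"
    and "(LINT x|M. LINT y|N. f (x, y)) = integral\<^sup>L (M \<Otimes>\<^sub>M N) f"
proof -
  interpret sigma_finite_measure N by fact
  have [measurable]: "f \<in> borel_measurable (M \<Otimes>\<^sub>M N)"
    using assms(2) by simp
  have eq: "(\<integral>\<^sup>+x. \<integral>\<^sup>+y. ennreal (f (x, y)) \<partial>N \<partial>M) = ennreal (integral\<^sup>L (M \<Otimes>\<^sub>M N) f)"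
    using assms(2,3) nn_integral_eq_integral[OF assms(2)] by (subst nn_integral_fst) auto
  have "AE x in M. (\<integral>\<^sup>+y. ennreal (f (x, y)) \<partial>N) \<noteq> \<infinity>"
    using eq by (intro nn_integral_PInf_AE) auto
  then show ae: "AE x in M. integrable N (\<lambda>y. f (x, y))"
    using AE_space by eventually_elim (auto intro!: integrableI_nonneg simp: assms(3) top.not_eq_extremum)
  have "(\<integral>\<^sup>+x. ennreal (LINT y|N. f (x, y)) \<partial>M) = (\<integral>\<^sup>+x. \<integral>\<^sup>+y. ennreal (f (x, y)) \<partial>N \<partial>M)"
    using ae by (intro nn_integral_cong_AE) (auto simp: nn_integral_eq_integral assms(3))
  with eq have "(\<integral>\<^sup>+x. ennreal (LINT y|N. f (x, y)) \<partial>M) = ennreal (integral\<^sup>L (M \<Otimes>\<^sub>M N) f)"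
    by simp
  moreover have "(\<lambda>x. LINT y|N. f (x, y)) \<in> borel_measurable M"
    by measurable
  ultimately have "has_bochner_integral M (\<lambda>x. LINT y|N. f (x, y)) (integral\<^sup>L (M \<Otimes>\<^sub>M N) f)"
    using assms(3) by (intro has_bochner_integral_nn_integral) auto
  then show "integrable M (\<lambda>x. LINT y|N. f (x, y))"
    and "(LINT x|M. LINT y|N. f (x, y)) = integral\<^sup>L (M \<Otimes>\<^sub>M N) f"
    by (simp_all add: has_bochner_integral_iff)
qed

lemma Fubini_real:
  fixes f :: "'a \<times> 'b \<Rightarrow> real"
  assumes "sigma_finite_measure N" "integrable (M \<Otimes>\<^sub>M N) f"
  shows "AE x in M. integrable N (\<lambda>y. f (x, y))"
    and "integrable M (\<lambda>x. LINT y|N. f (x, y))"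
    and "(LINT x|M. LINT y|N. f (x, y)) = integral\<^sup>L (M \<Otimes>\<^sub>M N) f"
proof -
  interpret sigma_finite_measure N by fact
  let ?p = "\<lambda>z. max 0 (f z)" and ?n = "\<lambda>z. max 0 (- f z)"
  have [measurable]: "f \<in> borel_measurable (M \<Otimes>\<^sub>M N)"
    using assms(2) by simp
  have f: "f z = ?p z - ?n z" for z by auto
  have p: "integrable (M \<Otimes>\<^sub>M N) ?p" and n: "integrable (M \<Otimes>\<^sub>M N) ?n"
    using assms(2) by auto
  note Fp = Fubini_nonneg[OF assms(1) p max.cobounded1] and Fn = Fubini_nonneg[OF assms(1) n max.cobounded1]
  \<comment> \<open>The inner integral splits into those of the positive and the negative part where
    both are integrable, that is, for almost every \<open>x\<close>.\<close>
  have ae: "AE x in M. integrable N (\<lambda>y. f (x, y)) \<and>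
      (LINT y|N. f (x, y)) = (LINT y|N. ?p (x, y)) - (LINT y|N. ?n (x, y))"
    using Fp(1) Fn(1)
  proof eventually_elim
    case (elim x)
    have "integrable N (\<lambda>y. ?p (x, y) - ?n (x, y))"
      using elim by (intro Bochner_Integration.integrable_diff) auto
    moreover have "(LINT y|N. ?p (x, y) - ?n (x, y)) = (LINT y|N. ?p (x, y)) - (LINT y|N. ?n (x, y))"
      using elim by (intro Bochner_Integration.integral_diff) auto
    ultimately show ?case using f by simp
  qed
  then show "AE x in M. integrable N (\<lambda>y. f (x, y))" by auto
  have diff: "integrable M (\<lambda>x. (LINT y|N. ?p (x, y)) - (LINT y|N. ?n (x, y)))"
    by (intro Bochner_Integration.integrable_diff Fp Fn)
  have m: "(\<lambda>x. LINT y|N. f (x, y)) \<in> borel_measurable M"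
    by measurable
  have ae': "AE x in M. (LINT y|N. ?p (x, y)) - (LINT y|N. ?n (x, y)) = (LINT y|N. f (x, y))"
    using ae by auto
  show "integrable M (\<lambda>x. LINT y|N. f (x, y))"
    using integrable_cong_AE[OF borel_measurable_integrable[OF diff] m ae'] diff by simp
  have "(LINT x|M. LINT y|N. f (x, y)) = (LINT x|M. (LINT y|N. ?p (x, y)) - (LINT y|N. ?n (x, y)))"
    using integral_cong_AE[OF borel_measurable_integrable[OF diff] m ae'] by simp
  also have "\<dots> = integral\<^sup>L (M \<Otimes>\<^sub>M N) ?p - integral\<^sup>L (M \<Otimes>\<^sub>M N) ?n"
    by (subst Bochner_Integration.integral_diff[OF Fp(2) Fn(2)]) (simp only: Fp(3) Fn(3))
  also have "\<dots> = (LINT z|(M \<Otimes>\<^sub>M N). ?p z - ?n z)"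
    using p n by (rule Bochner_Integration.integral_diff[symmetric])
  finally show "(LINT x|M. LINT y|N. f (x, y)) = integral\<^sup>L (M \<Otimes>\<^sub>M N) f"
    using f by simp
qed

lemma Fubini_complex:
  fixes f :: "'a \<times> 'b \<Rightarrow> complex"
  assumes "sigma_finite_measure N" "integrable (M \<Otimes>\<^sub>M N) f"
  shows "(LINT x|M. LINT y|N. f (x, y)) = integral\<^sup>L (M \<Otimes>\<^sub>M N) f"
proof -
  interpret sigma_finite_measure N by fact
  let ?r = "\<lambda>z. Re (f z)" and ?i = "\<lambda>z. Im (f z)"
  have [measurable]: "f \<in> borel_measurable (M \<Otimes>\<^sub>M N)"
    using assms(2) by simp
  have r: "integrable (M \<Otimes>\<^sub>M N) ?r" and i: "integrable (M \<Otimes>\<^sub>M N) ?i"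
    using assms(2) by auto
  note Fr = Fubini_real[OF assms(1) r] and Fi = Fubini_real[OF assms(1) i]
  let ?I = "\<lambda>x. complex_of_real (LINT y|N. ?r (x, y)) + \<i> * complex_of_real (LINT y|N. ?i (x, y))"
  have "AE x in M. (LINT y|N. f (x, y)) = ?I x"
    using Fr(1) Fi(1)
  proof eventually_elim
    case (elim x)
    then have "integrable N (\<lambda>y. f (x, y))"
      by (subst complex_eq)
        (intro Bochner_Integration.integrable_add integrable_mult_right integrable_of_real; simp)
    then show ?case
      by (simp add: complex_eq_iff)
  qed
  then have "(LINT x|M. LINT y|N. f (x, y)) = (LINT x|M. ?I x)"
    by (intro integral_cong_AE) auto
  also have "\<dots> = complex_of_real (LINT x|M. LINT y|N. ?r (x, y)) + \<i> * complex_of_real (LINT x|M. LINT y|N. ?i (x, y))"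
    using Fr(2) Fi(2) by (subst Bochner_Integration.integral_add) auto
  also have "\<dots> = integral\<^sup>L (M \<Otimes>\<^sub>M N) f"
    using assms(2) by (simp add: Fr(3) Fi(3) complex_eq_iff)
  finally show ?thesis .
qed

lemma measurable_L2_section:
  assumes "g \<in> L2 (M \<Otimes>\<^sub>M N)" "x \<in> space M"
  shows "(\<lambda>y. g (x, y)) \<in> borel_measurable N"
  using assms L2_measurable by (intro measurable_Pair2) auto

lemma L2_sections:
  assumes "sigma_finite_measure N" "g \<in> L2 (M \<Otimes>\<^sub>M N)"
  shows "AE x in M. (\<lambda>y. g (x, y)) \<in> L2 N"
  using Fubini_nonneg(1)[OF assms(1) L2_integrable_square[OF assms(2)] zero_le_power2] AE_space
  by (eventually_elim) (auto simp: L2_def intro: measurable_L2_section[OF assms(2)])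

lemma L2_inner_pair:
  assumes "sigma_finite_measure N" "f \<in> L2 (M \<Otimes>\<^sub>M N)" "g \<in> L2 (M \<Otimes>\<^sub>M N)"
  shows "L2_inner (M \<Otimes>\<^sub>M N) f g = (LINT x|M. L2_inner N (\<lambda>y. f (x, y)) (\<lambda>y. g (x, y)))"
  unfolding L2_inner_def using Fubini_complex[OF assms(1) L2_integrable_mult_cnj[OF assms(2,3)]] by simp

text \<open>Where the integrand is not integrable the integral has the default value 0, so joint
  measurability suffices and no exceptional set has to be removed.\<close>

lemma measurable_L2_inner_sections:
  assumes "sigma_finite_measure N"
    and "f \<in> borel_measurable (M \<Otimes>\<^sub>M N)" "g \<in> borel_measurable (M \<Otimes>\<^sub>M N)"
  shows "(\<lambda>x. L2_inner N (\<lambda>y. f (x, y)) (\<lambda>y. g (x, y))) \<in> borel_measurable M"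
proof -
  interpret sigma_finite_measure N by fact
  have [measurable]: "cnj \<in> borel_measurable borel"
    by (intro borel_measurable_continuous_onI continuous_intros)
  note assms(2,3)[measurable]
  show ?thesis
    unfolding L2_inner_def by measurable
qed

lemma L2_tensor:
  assumes "sigma_finite_measure N" "f \<in> L2 M" "g \<in> L2 N"
  shows "(\<lambda>(u, v). f u * g v) \<in> L2 (M \<Otimes>\<^sub>M N)"
proof -
  interpret sigma_finite_measure N by fact
  note [measurable] = assms(2,3)[THEN L2_measurable]
  have "(\<integral>\<^sup>+z. ennreal ((cmod (case z of (u, v) \<Rightarrow> f u * g v))\<^sup>2) \<partial>(M \<Otimes>\<^sub>M N)) =
      (\<integral>\<^sup>+x. \<integral>\<^sup>+y. ennreal ((cmod (f x))\<^sup>2) * ennreal ((cmod (g y))\<^sup>2) \<partial>N \<partial>M)"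
    by (subst nn_integral_fst[symmetric]) (auto simp: norm_mult power_mult_distrib ennreal_mult)
  also have "\<dots> = ennreal ((L2_norm M f)\<^sup>2) * ennreal ((L2_norm N g)\<^sup>2)"
    using assms(2,3) by (simp add: nn_integral_cmult nn_integral_multc nn_integral_cmod_square)
  finally have "(\<integral>\<^sup>+z. ennreal ((cmod (case z of (u, v) \<Rightarrow> f u * g v))\<^sup>2) \<partial>(M \<Otimes>\<^sub>M N)) < \<infinity>"
    by (simp add: ennreal_mult_less_top)
  then show ?thesis
    unfolding L2_iff_nn_integral by simp
qed

lemma L2_inner_tensor:
  assumes "sigma_finite_measure N" "f \<in> L2 M" "g \<in> L2 N" "f' \<in> L2 M" "g' \<in> L2 N"
  shows "L2_inner (M \<Otimes>\<^sub>M N) (\<lambda>(u, v). f u * g v) (\<lambda>(u, v). f' u * g' v) =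
    L2_inner M f f' * L2_inner N g g'"
proof -
  have "L2_inner (M \<Otimes>\<^sub>M N) (\<lambda>(u, v). f u * g v) (\<lambda>(u, v). f' u * g' v) =
      (LINT x|M. L2_inner N (\<lambda>y. f x * g y) (\<lambda>y. f' x * g' y))"
    using assms by (subst L2_inner_pair) (auto intro: L2_tensor)
  also have "\<dots> = (LINT x|M. f x * cnj (f' x) * L2_inner N g g')"
    by (simp add: L2_inner_scale_left L2_inner_scale_right mult_ac)
  also have "\<dots> = L2_inner M f f' * L2_inner N g g'"
    by (simp add: L2_inner_def)
  finally show ?thesis .
qed


section \<open>The operator \<open>F \<otimes> I\<close> is isometric\<close>

lemma L2_indicator:
  assumes "A \<in> sets M" "emeasure M A < \<infinity>"
  shows "(indicator A :: _ \<Rightarrow> complex) \<in> L2 M"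
proof -
  have "(cmod (indicator A x))\<^sup>2 = indicator A x" for x
    by (simp split: split_indicator)
  then show ?thesis
    using assms by (simp add: L2_def)
qed

text \<open>By sigma-finiteness, countably many rectangles with sides of finite measure cover the
  space. On each of them \<open>w\<close> is integrable, and an integrable function whose integrals
  over all rectangles vanish is null.\<close>

lemma L2_eq_0_if_orthogonal_to_rectangles:
  assumes "sigma_finite_measure M" "sigma_finite_measure N" "w \<in> L2 (M \<Otimes>\<^sub>M N)"
    and orth: "\<And>A B. A \<in> sets M \<Longrightarrow> emeasure M A < \<infinity> \<Longrightarrow> B \<in> sets N \<Longrightarrow> emeasure N B < \<infinity> \<Longrightarrow>
      L2_inner (M \<Otimes>\<^sub>M N) w (\<lambda>(u, v). indicator A u * indicator B v) = 0"
  shows "AE z in M \<Otimes>\<^sub>M N. w z = 0"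
proof -
  interpret M: sigma_finite_measure M by fact
  interpret N: sigma_finite_measure N by fact
  have rect: "AE z in M \<Otimes>\<^sub>M N. z \<in> A \<times> B \<longrightarrow> w z = 0"
    if A: "A \<in> sets M" "emeasure M A < \<infinity>" and B: "B \<in> sets N" "emeasure N B < \<infinity>" for A B
  proof -
    \<comment> \<open>\<open>w\<close> itself need not be integrable; its product with the indicator
      of a set of finite measure is, as a product of two functions in L2.\<close>
    define u where "u z = w z * indicator (A \<times> B) z" for z
    have AB: "A \<times> B \<in> sets (M \<Otimes>\<^sub>M N)" "emeasure (M \<Otimes>\<^sub>M N) (A \<times> B) < \<infinity>"
      using A B by (auto simp: N.emeasure_pair_measure_Times ennreal_mult_less_top)
    have "integrable (M \<Otimes>\<^sub>M N) (\<lambda>z. w z * cnj (indicator (A \<times> B) z))"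
      using assms(3) AB by (intro L2_integrable_mult_cnj L2_indicator)
    moreover have "cnj (indicator S z) = indicator S z" for S and z :: "'a \<times> 'b"
      by (simp split: split_indicator)
    ultimately have u: "integrable (M \<Otimes>\<^sub>M N) u"
      unfolding u_def[abs_def] by simp
    \<comment> \<open>\<open>C\<close> and \<open>D\<close> may have infinite measure; the cut-off
      in \<open>u\<close> replaces them by their intersections with \<open>A\<close> and
      \<open>B\<close>, to which orthogonality applies.\<close>
    have base: "(LINT z:C \<times> D|(M \<Otimes>\<^sub>M N). u z) = 0" if "C \<in> sets M" "D \<in> sets N" for C D
    proof -
      have fin: "emeasure M (C \<inter> A) < \<infinity>" "emeasure N (D \<inter> B) < \<infinity>"
        using le_less_trans[OF emeasure_mono[OF Int_lower2 A(1)] A(2)]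
          le_less_trans[OF emeasure_mono[OF Int_lower2 B(1)] B(2)] .
      have "(LINT z:C \<times> D|(M \<Otimes>\<^sub>M N). u z) =
          L2_inner (M \<Otimes>\<^sub>M N) w (\<lambda>(u, v). indicator (C \<inter> A) u * indicator (D \<inter> B) v)"
        unfolding set_lebesgue_integral_def L2_inner_def
      proof (rule Bochner_Integration.integral_cong[OF refl])
        fix z
        show "indicator (C \<times> D) z *\<^sub>R u z =
            w z * cnj (case z of (u, v) \<Rightarrow> indicator (C \<inter> A) u * indicator (D \<inter> B) v)"
          unfolding u_def
          by (cases z; cases "fst z \<in> C"; cases "fst z \<in> A"; cases "snd z \<in> B"; cases "snd z \<in> D"; simp)
      qed
      also have "\<dots> = 0"
        using that A B fin by (intro orth) auto
      finally show ?thesis .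
    qed
    \<comment> \<open>Dynkin's argument: rectangles are stable under intersection, and the vanishing
      of the integral passes to complements, the whole space being a rectangle, and to countable
      disjoint unions.\<close>
    have zero: "(LINT z:E|(M \<Otimes>\<^sub>M N). u z) = 0" if "E \<in> sets (M \<Otimes>\<^sub>M N)" for E
      using Int_stable_pair_measure_generator pair_measure_closed that[unfolded sets_pair_measure]
    proof (induction rule: sigma_sets_induct_disjoint)
      case (basic E)
      then show ?case by (auto intro: base)
    next
      case empty
      then show ?case by (simp add: set_lebesgue_integral_def)
    next
      case (compl E)
      have E: "E \<in> sets (M \<Otimes>\<^sub>M N)"
        using compl(1) by (simp only: sets_pair_measure)
      have E': "E \<subseteq> space M \<times> space N"
        using sets.sets_into_space[OF E] by (simp only: space_pair_measure)
      have int: "set_integrable (M \<Otimes>\<^sub>M N) S u" if "S \<in> sets (M \<Otimes>\<^sub>M N)" for S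
        using u that unfolding set_integrable_def by (rule integrable_mult_indicator[rotated])
      have "(LINT z:space M \<times> space N|(M \<Otimes>\<^sub>M N). u z) =
          (LINT z:(space M \<times> space N - E) \<union> E|(M \<Otimes>\<^sub>M N). u z)"
        using E' by (simp only: Un_Diff_cancel2 Un_absorb2)
      also have "\<dots> = (LINT z:space M \<times> space N - E|(M \<Otimes>\<^sub>M N). u z) + (LINT z:E|(M \<Otimes>\<^sub>M N). u z)"
        using E by (intro set_integral_Un int) auto
      finally show ?case
        using compl(2) base[of "space M" "space N"] by simp
    next
      case (union E)
      have E: "E i \<in> sets (M \<Otimes>\<^sub>M N)" for i
        using union(2) by (auto simp: sets_pair_measure)
      have "set_integrable (M \<Otimes>\<^sub>M N) (\<Union>i. E i) u"
        using u E unfolding set_integrable_def by (intro integrable_mult_indicator) auto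
      then have "(LINT z:(\<Union>i. E i)|(M \<Otimes>\<^sub>M N). u z) = (\<Sum>i. LINT z:E i|(M \<Otimes>\<^sub>M N). u z)"
        using E union(1) by (intro lebesgue_integral_countable_add) (auto simp: disjoint_family_on_def)
      then show ?case
        using union(3) by simp
    qed
    have setint: "integrable (M \<Otimes>\<^sub>M N) (\<lambda>z. indicator E z *\<^sub>R u z)" if "E \<in> sets (M \<Otimes>\<^sub>M N)" for E
      using that u by (rule integrable_mult_indicator)
    \<comment> \<open>Set integrals determine a real density almost everywhere, so real and
      imaginary part are treated separately.\<close>
    have "AE z in M \<Otimes>\<^sub>M N. Re (u z) = 0"
    proof (rule density_unique_real)
      fix E assume E: "E \<in> sets (M \<Otimes>\<^sub>M N)"
      show "(LINT z:E|(M \<Otimes>\<^sub>M N). Re (u z)) = (LINT z:E|(M \<Otimes>\<^sub>M N). 0)"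
        using zero[OF E] integral_Re[OF setint[OF E]] unfolding set_lebesgue_integral_def by simp
    qed (use u in auto)
    moreover have "AE z in M \<Otimes>\<^sub>M N. Im (u z) = 0"
    proof (rule density_unique_real)
      fix E assume E: "E \<in> sets (M \<Otimes>\<^sub>M N)"
      show "(LINT z:E|(M \<Otimes>\<^sub>M N). Im (u z)) = (LINT z:E|(M \<Otimes>\<^sub>M N). 0)"
        using zero[OF E] integral_Im[OF setint[OF E]] unfolding set_lebesgue_integral_def by simp
    qed (use u in auto)
    ultimately show ?thesis
    proof eventually_elim
      case (elim z)
      then have "u z = 0" by (simp add: complex_eq_iff)
      then have "w z = 0" if "z \<in> A \<times> B"
        using that by (simp add: u_def)
      then show ?case by blast
    qed
  qed
  obtain A :: "nat \<Rightarrow> _" where A: "range A \<subseteq> sets M" "(\<Union>i. A i) = space M" "\<And>i. emeasure M (A i) \<noteq> \<infinity>"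
    using M.sigma_finite by blast
  obtain B :: "nat \<Rightarrow> _" where B: "range B \<subseteq> sets N" "(\<Union>i. B i) = space N" "\<And>i. emeasure N (B i) \<noteq> \<infinity>"
    using N.sigma_finite by blast
  have "AE z in M \<Otimes>\<^sub>M N. \<forall>i j. z \<in> A i \<times> B j \<longrightarrow> w z = 0"
    unfolding AE_all_countable using A B by (auto intro!: rect simp: top.not_eq_extremum)
  then show ?thesis
    using AE_space
  proof eventually_elim
    case (elim z)
    have "fst z \<in> (\<Union>i. A i)" "snd z \<in> (\<Union>i. B i)"
      unfolding A(2) B(2) using elim(2) by (auto simp: space_pair_measure)
    then obtain i j where "fst z \<in> A i" "snd z \<in> B j"
      by blast
    with elim(1) show ?case by (metis mem_Times_iff)
  qed
qed

text \<open>On pairs of elementary tensors isometry is a computation. It is extended one argument at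
  a time: totality of rectangles gives that \<open>V' (V t)\<close> is \<open>t\<close> for tensors
  \<open>t\<close>; moving \<open>V\<close> to the tensor by the adjoint then gives isometry of an
  arbitrary \<open>f\<close> against tensors, and totality applies again.\<close>

lemma L2_tensor_id_adjoint_inverse:
  assumes M: "sigma_finite_measure M" and N: "sigma_finite_measure N"
    and T: "L2_unitary M M' T" and V: "L2_tensor_id M M' N T V"
    and V': "L2_adjoint (M \<Otimes>\<^sub>M N) (M' \<Otimes>\<^sub>M N) V V'"
    and f: "f \<in> L2 (M \<Otimes>\<^sub>M N)"
  shows "AE z in M \<Otimes>\<^sub>M N. V' (V f) z = f z"
proof -
  let ?MN = "M \<Otimes>\<^sub>M N" and ?MN' = "M' \<Otimes>\<^sub>M N"
  have V_op: "L2_operator ?MN ?MN' V" and V'_op: "L2_operator ?MN' ?MN V'"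
    using V V' by (auto simp: L2_tensor_id_def L2_adjoint_def)
  note V_L2 = L2_operator_L2[OF V_op] and V'_L2 = L2_operator_L2[OF V'_op]
  have adj: "L2_inner ?MN' (V f) g = L2_inner ?MN f (V' g)" if "f \<in> L2 ?MN" "g \<in> L2 ?MN'" for f g
    using V' that by (auto simp: L2_adjoint_def)
  have adj': "L2_inner ?MN (V' (V f)) g = L2_inner ?MN' (V f) (V g)"
    if "f \<in> L2 ?MN" "g \<in> L2 ?MN" for f g
    using adj[OF that(2) V_L2[OF that(1)]] L2_inner_commute by metis
  have T_op: "L2_operator M M' T"
    using T by (simp add: L2_unitary_def)
  have TL2: "T a \<in> L2 M'" if "a \<in> L2 M" for a
    using L2_operator_L2[OF T_op that] .
  have tensors: "L2_inner ?MN' (V (\<lambda>(u, v). a u * b v)) (V (\<lambda>(u, v). a' u * b' v)) =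
      L2_inner ?MN (\<lambda>(u, v). a u * b v) (\<lambda>(u, v). a' u * b' v)"
    if ab: "a \<in> L2 M" "b \<in> L2 N" "a' \<in> L2 M" "b' \<in> L2 N" for a b a' b'
  proof -
    have AE: "AE z in ?MN'. V (\<lambda>(u, v). a u * b v) z = (\<lambda>(u, v). T a u * b v) z"
      if "a \<in> L2 M" "b \<in> L2 N" for a b
      using V that by (simp add: L2_tensor_id_def case_prod_unfold)
    have "L2_inner ?MN' (V (\<lambda>(u, v). a u * b v)) (V (\<lambda>(u, v). a' u * b' v)) =
        L2_inner ?MN' (\<lambda>(u, v). T a u * b v) (\<lambda>(u, v). T a' u * b' v)"
      using ab by (intro L2_inner_cong_AE AE V_L2 L2_tensor N TL2)
    also have "\<dots> = L2_inner M a a' * L2_inner N b b'"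
      using ab T by (subst L2_inner_tensor) (auto intro: N TL2 simp: L2_unitary_def)
    also have "\<dots> = L2_inner ?MN (\<lambda>(u, v). a u * b v) (\<lambda>(u, v). a' u * b' v)"
      using ab by (subst L2_inner_tensor) (auto intro: N)
    finally show ?thesis .
  qed
  have reduce: "AE z in ?MN. V' (V h) z = h z"
    if h: "h \<in> L2 ?MN" and isom: "\<And>a b. a \<in> L2 M \<Longrightarrow> b \<in> L2 N \<Longrightarrow>
      L2_inner ?MN' (V h) (V (\<lambda>(u, v). a u * b v)) = L2_inner ?MN h (\<lambda>(u, v). a u * b v)" for h
  proof -
    note VVh = V'_L2[OF V_L2[OF h]]
    have "AE z in ?MN. V' (V h) z - h z = 0"
    proof (rule L2_eq_0_if_orthogonal_to_rectangles[OF M N])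
      show "(\<lambda>z. V' (V h) z - h z) \<in> L2 ?MN"
        using VVh h by (rule L2_diff)
      fix A B
      assume "A \<in> sets M" "emeasure M A < \<infinity>" "B \<in> sets N" "emeasure N B < \<infinity>"
      then have A: "(indicator A :: _ \<Rightarrow> complex) \<in> L2 M" and B: "(indicator B :: _ \<Rightarrow> complex) \<in> L2 N"
        by (auto intro: L2_indicator)
      note t = L2_tensor[OF N A B]
      show "L2_inner ?MN (\<lambda>z. V' (V h) z - h z) (\<lambda>(u, v). indicator A u * indicator B v) = 0"
        unfolding L2_inner_diff_left[OF VVh h t] adj'[OF h t] isom[OF A B] by simp
    qed
    then show ?thesis by simp
  qed
  have fixed: "AE z in ?MN. V' (V (\<lambda>(u, v). a u * b v)) z = (\<lambda>(u, v). a u * b v) z"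
    if "a \<in> L2 M" "b \<in> L2 N" for a b
    using that by (intro reduce L2_tensor tensors N)
  show ?thesis
  proof (rule reduce[OF f])
    fix a b assume ab: "a \<in> L2 M" "b \<in> L2 N"
    note t = L2_tensor[OF N ab]
    show "L2_inner ?MN' (V f) (V (\<lambda>(u, v). a u * b v)) = L2_inner ?MN f (\<lambda>(u, v). a u * b v)"
      unfolding adj[OF f V_L2[OF t]]
      by (rule L2_inner_cong_AE[OF AE_I2 fixed[OF ab] f V'_L2[OF V_L2[OF t]] f t]) simp
  qed
qed

text \<open>Haar measure is finite on the compact sets that cover the group. Metrizability makes the
  group Hausdorff, which the type class does not, so that compact sets are closed and thus
  Borel.\<close>

lemma sigma_finite_haar_measure:
  fixes \<nu> :: "'g::topological_ab_group_add measure"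
  assumes "haar_measure euclidean (+) \<nu>" "metrizable_space (euclidean :: 'g topology)"
    and "sigma_compact (UNIV :: 'g set)"
  shows "sigma_finite_measure \<nu>"
proof
  obtain K :: "nat \<Rightarrow> 'g set" where K: "\<And>n. compact (K n)" "(\<Union>n. K n) = UNIV"
    using assms(3) unfolding sigma_compact_def by blast
  have haar: "space \<nu> = UNIV" "sets \<nu> = sigma_sets UNIV {U. open U}" "\<And>n. emeasure \<nu> (K n) < \<infinity>"
    using assms(1) K(1) unfolding haar_measure_def by auto
  have "closed (K n)" for n
    using K(1)[of n] metrizable_imp_Hausdorff_space[OF assms(2)] compactin_imp_closedin
    by (metis compactin_euclidean_iff closed_closedin)
  then have "UNIV - (UNIV - K n) \<in> sigma_sets UNIV {U. open U}" for n
    by (intro sigma_sets.Compl sigma_sets.Basic) (simp add: open_Diff)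
  then have "K n \<in> sets \<nu>" for n
    by (simp add: haar(2) double_diff)
  then show "\<exists>A. countable A \<and> A \<subseteq> sets \<nu> \<and> \<Union> A = space \<nu> \<and> (\<forall>a\<in>A. emeasure \<nu> a \<noteq> \<infinity>)"
    using K(2) haar(1,3) by (intro exI[of _ "range K"]) (auto simp: less_top[symmetric])
qed


section \<open>Measurable fields of vectors\<close>

text \<open>The squared errors have summable integrals, so their sum is finite almost everywhere and
  the terms tend to 0 there. Convergence in norm without a rate would give this only along a
  subsequence.\<close>

lemma L2_AE_tendsto:
  assumes f: "f \<in> L2 M" and s: "\<And>i. s i \<in> L2 M"
    and le: "\<And>i::nat. (L2_norm M (\<lambda>x. f x - s i x))\<^sup>2 \<le> (1 / 2) ^ i"
  shows "AE x in M. (\<lambda>i. s i x) \<longlonglongrightarrow> f x"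
proof -
  have d: "(\<lambda>x. f x - s i x) \<in> L2 M" for i
    using f s by (rule L2_diff)
  note [measurable] = L2_measurable[OF d]
  have "(\<integral>\<^sup>+x. (\<Sum>i. ennreal ((cmod (f x - s i x))\<^sup>2)) \<partial>M) =
      (\<Sum>i. \<integral>\<^sup>+x. ennreal ((cmod (f x - s i x))\<^sup>2) \<partial>M)"
    by (rule nn_integral_suminf) measurable
  also have "\<dots> \<le> (\<Sum>i. ennreal ((1 / 2) ^ i))"
    unfolding nn_integral_cmod_square[OF d] using le by (intro suminf_le ennreal_leI summableI)
  also have "\<dots> < \<infinity>"
    by (subst suminf_ennreal2) (auto intro: summable_geometric)
  finally have "AE x in M. (\<Sum>i. ennreal ((cmod (f x - s i x))\<^sup>2)) \<noteq> \<infinity>"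
    by (intro nn_integral_PInf_AE) auto
  then show ?thesis
  proof eventually_elim
    case (elim x)
    have "summable (\<lambda>i. (cmod (f x - s i x))\<^sup>2)"
      using elim by (intro summable_suminf_not_top) auto
    from tendsto_real_sqrt[OF summable_LIMSEQ_zero[OF this]]
    have "(\<lambda>i. cmod (f x - s i x)) \<longlonglongrightarrow> 0" by simp
    then have "(\<lambda>i. f x - s i x) \<longlonglongrightarrow> 0"
      by (rule tendsto_norm_zero_cancel)
    from tendsto_diff[OF tendsto_const[of "f x"] this] show ?case by simp
  qed
qed

text \<open>Measurability is tested against the constant fields \<open>e j\<close>, which form an
  orthonormal basis at every \<xi>, and not against the fundamental sequence of the direct integral;
  for fields with values in the fibres the two tests agree by \<open>inner_P_basis\<close>.\<close>

definition measurable_field ::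
    "'x measure \<Rightarrow> 'y measure \<Rightarrow> (nat \<Rightarrow> 'y \<Rightarrow> complex) \<Rightarrow> nat set \<Rightarrow> ('x \<Rightarrow> 'y \<Rightarrow> complex) \<Rightarrow> bool" where
  "measurable_field M N e J k \<longleftrightarrow>
     (\<forall>\<xi>\<in>space M. k \<xi> \<in> L2 N) \<and> (\<forall>j\<in>J. (\<lambda>\<xi>. L2_inner N (k \<xi>) (e j)) \<in> borel_measurable M)"

text \<open>By Parseval the function is a pointwise limit of finite sums of products of measurable
  coefficients.\<close>

lemma measurable_field_inner:
  assumes onb: "L2_onb N (L2 N) e J" and k: "measurable_field M N e J k" and l: "measurable_field M N e J l"
  shows "(\<lambda>\<xi>. L2_inner N (k \<xi>) (l \<xi>)) \<in> borel_measurable M"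
proof (rule borel_measurable_LIMSEQ_metric)
  have [measurable]: "cnj \<in> borel_measurable borel"
    by (intro borel_measurable_continuous_onI continuous_intros)
  have [measurable]: "(\<lambda>\<xi>. L2_inner N (k \<xi>) (e j)) \<in> borel_measurable M"
      "(\<lambda>\<xi>. L2_inner N (l \<xi>) (e j)) \<in> borel_measurable M" if "j \<in> J" for j
    using k l that by (auto simp: measurable_field_def)
  show "(\<lambda>\<xi>. \<Sum>j\<in>J \<inter> {..<n}. L2_inner N (k \<xi>) (e j) * cnj (L2_inner N (l \<xi>) (e j))) \<in> borel_measurable M" for n
    by measurable
  show "(\<lambda>n. \<Sum>j\<in>J \<inter> {..<n}. L2_inner N (k \<xi>) (e j) * cnj (L2_inner N (l \<xi>) (e j)))
      \<longlonglongrightarrow> L2_inner N (k \<xi>) (l \<xi>)" if "\<xi> \<in> space M" for \<xi>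
    unfolding L2_inner_commute[of N _ "l \<xi>", symmetric]
    using k l that by (intro Parseval_inner onb) (auto simp: measurable_field_def)
qed

lemma measurable_field_norm_square:
  assumes "L2_onb N (L2 N) e J" "measurable_field M N e J k"
  shows "(\<lambda>\<xi>. (L2_norm N (k \<xi>))\<^sup>2) \<in> borel_measurable M"
proof -
  have "(\<lambda>\<xi>. Re (L2_inner N (k \<xi>) (k \<xi>))) \<in> borel_measurable M"
    using measurable_field_inner[OF assms assms(2)] by measurable
  then show ?thesis
    by (simp add: L2_inner_self del: of_real_power)
qed

text \<open>
  The expansion of \<open>k \<xi>\<close> is truncated at an index that depends measurably on \<open>\<xi>\<close>.  The
  truncations then converge so fast in every fibre that they converge almost everywhere, and no
  completeness of \<open>L\<^sup>2\<close> of the product is needed.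
\<close>

lemma measurable_field_joint_representative:
  assumes N: "sigma_finite_measure N" and onb: "L2_onb N (L2 N) e J"
    and k: "measurable_field M N e J k" and int: "integrable M (\<lambda>\<xi>. (L2_norm N (k \<xi>))\<^sup>2)"
  obtains g where "g \<in> L2 (M \<Otimes>\<^sub>M N)" "\<And>\<xi>. \<xi> \<in> space M \<Longrightarrow> AE y in N. g (\<xi>, y) = k \<xi> y"
proof -
  interpret sigma_finite_measure N by fact
  have kL2: "k \<xi> \<in> L2 N" if "\<xi> \<in> space M" for \<xi>
    using k that by (simp add: measurable_field_def)
  have [measurable]: "(\<lambda>\<xi>. L2_inner N (k \<xi>) (e j)) \<in> borel_measurable M" if "j \<in> J" for j
    using k that by (simp add: measurable_field_def)
  have [measurable]: "e j \<in> borel_measurable N" if "j \<in> J" for j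
    using L2_onbD(1)[OF onb that] by (rule L2_measurable)
  have [measurable]: "(\<lambda>\<xi>. (L2_norm N (k \<xi>))\<^sup>2) \<in> borel_measurable M"
    using onb k by (rule measurable_field_norm_square)
  \<comment> \<open>By Pythagoras \<open>r n \<xi>\<close> is the squared error of truncating at
    \<open>n\<close>; written through the coefficients it is visibly measurable in \<xi>.\<close>
  define r where "r n \<xi> = (L2_norm N (k \<xi>))\<^sup>2 - (\<Sum>j\<in>J \<inter> {..<n}. (cmod (L2_inner N (k \<xi>) (e j)))\<^sup>2)" for n \<xi>
  have [measurable]: "r n \<in> borel_measurable M" for n
    unfolding r_def by measurable
  define m where "m i \<xi> = (LEAST n. r n \<xi> \<le> (1 / 2) ^ i)" for i \<xi>
  have [measurable]: "m i \<in> measurable M (count_space UNIV)" for i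
    unfolding m_def by measurable
  define G where "G i z = partial_expansion N e J (k (fst z)) (m i (fst z)) (snd z)" for i z
  \<comment> \<open>The index takes countably many values, and for a fixed index the expansion is a
    finite sum of products of a function of \<xi> and a function of \<open>y\<close>.\<close>
  have [measurable]: "G i \<in> borel_measurable (M \<Otimes>\<^sub>M N)" for i
    unfolding G_def
    by (rule measurable_compose_countable[where g = "\<lambda>z. m i (fst z)"])
      (unfold partial_expansion_def, measurable)
  \<comment> \<open>\<open>lim\<close> has some value also where the sequence diverges; in every
    fibre this happens only on a null set.\<close>
  define g where "g z = lim (\<lambda>i. G i z)" for z
  have g_meas: "g \<in> borel_measurable (M \<Otimes>\<^sub>M N)"
    unfolding g_def by measurable
  have g_eq: "AE y in N. g (\<xi>, y) = k \<xi> y" if \<xi>: "\<xi> \<in> space M" for \<xi>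
  proof -
    have "\<exists>n. r n \<xi> \<le> (1 / 2) ^ i" for i
    proof -
      have "(\<lambda>n. r n \<xi>) \<longlonglongrightarrow> (L2_norm N (k \<xi>))\<^sup>2 - (L2_norm N (k \<xi>))\<^sup>2"
        unfolding r_def by (intro tendsto_intros Parseval_norm onb kL2 \<xi>)
      then have "\<forall>\<^sub>F n in sequentially. r n \<xi> < (1 / 2) ^ i"
        by (intro order_tendstoD(2)) auto
      from eventually_happens[OF this] show ?thesis
        by (auto intro: less_imp_le)
    qed
    then have "r (m i \<xi>) \<xi> \<le> (1 / 2) ^ i" for i
      unfolding m_def by (rule LeastI_ex)
    then have "AE y in N. (\<lambda>i. partial_expansion N e J (k \<xi>) (m i \<xi>) y) \<longlonglongrightarrow> k \<xi> y"
      unfolding r_def L2_norm_diff_partial_expansion[OF onb kL2[OF \<xi>], symmetric]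
      by (intro L2_AE_tendsto kL2 \<xi> partial_expansion_L2 onb)
    then show ?thesis
      by eventually_elim (simp add: g_def G_def limI)
  qed
  have "(\<integral>\<^sup>+z. ennreal ((cmod (g z))\<^sup>2) \<partial>(M \<Otimes>\<^sub>M N)) =
      (\<integral>\<^sup>+\<xi>. \<integral>\<^sup>+y. ennreal ((cmod (g (\<xi>, y)))\<^sup>2) \<partial>N \<partial>M)"
    using g_meas by (subst nn_integral_fst[symmetric]) auto
  also have "\<dots> = (\<integral>\<^sup>+\<xi>. ennreal ((L2_norm N (k \<xi>))\<^sup>2) \<partial>M)"
  proof (rule nn_integral_cong)
    fix \<xi> assume \<xi>: "\<xi> \<in> space M"
    have "(\<integral>\<^sup>+y. ennreal ((cmod (g (\<xi>, y)))\<^sup>2) \<partial>N) = (\<integral>\<^sup>+y. ennreal ((cmod (k \<xi> y))\<^sup>2) \<partial>N)"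
      using g_eq[OF \<xi>] by (intro nn_integral_cong_AE) (auto elim: AE_mp)
    then show "(\<integral>\<^sup>+y. ennreal ((cmod (g (\<xi>, y)))\<^sup>2) \<partial>N) = ennreal ((L2_norm N (k \<xi>))\<^sup>2)"
      by (simp add: nn_integral_cmod_square[OF kL2[OF \<xi>]])
  qed
  also have "\<dots> < \<infinity>"
    using nn_integral_eq_integral[OF int] by simp
  finally have "g \<in> L2 (M \<Otimes>\<^sub>M N)"
    unfolding L2_iff_nn_integral using g_meas by simp
  then show ?thesis
    using g_eq by (rule that)
qed

text \<open>A field must lie in L2 at every point, but a section of \<open>g\<close> does so only
  almost everywhere; the other sections are set to 0. The points concerned form a measurable set,
  being those where the integral of the squared modulus is infinite.\<close>

lemma section_measurable_field:
  assumes N: "sigma_finite_measure N" and onb: "L2_onb N (L2 N) e J" and g: "g \<in> L2 (M \<Otimes>\<^sub>M N)"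
  shows "measurable_field M N e J (\<lambda>\<xi> y. if (\<lambda>y. g (\<xi>, y)) \<in> L2 N then g (\<xi>, y) else 0)"
  unfolding measurable_field_def
proof (intro conjI ballI)
  interpret sigma_finite_measure N by fact
  note [measurable] = L2_measurable[OF g]
  have if_eq: "(\<lambda>y. if b then f y else 0) = (if b then f else (\<lambda>y. 0))" for b and f :: "'b \<Rightarrow> complex"
    by auto
  show "(\<lambda>y. if (\<lambda>y. g (\<xi>, y)) \<in> L2 N then g (\<xi>, y) else 0) \<in> L2 N" for \<xi>
    by (cases "(\<lambda>y. g (\<xi>, y)) \<in> L2 N") simp_all
  fix j assume "j \<in> J"
  then have [measurable]: "e j \<in> borel_measurable N"
    using L2_onbD(1)[OF onb] L2_measurable by blast
  have "{\<xi> \<in> space M. (\<lambda>y. g (\<xi>, y)) \<in> L2 N} =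
      {\<xi> \<in> space M. (\<integral>\<^sup>+y. ennreal ((cmod (g (\<xi>, y)))\<^sup>2) \<partial>N) < \<infinity>}"
    unfolding L2_iff_nn_integral using measurable_L2_section[OF g] by auto
  moreover have "\<dots> \<in> sets M" by measurable
  ultimately have [measurable]: "Measurable.pred M (\<lambda>\<xi>. (\<lambda>y. g (\<xi>, y)) \<in> L2 N)"
    by (simp add: pred_def)
  have "(\<lambda>\<xi>. L2_inner N (\<lambda>y. g (\<xi>, y)) (e j)) \<in> borel_measurable M"
    using measurable_L2_inner_sections[OF N L2_measurable[OF g], of "\<lambda>z. e j (snd z)"] by simp
  then have "(\<lambda>\<xi>. if (\<lambda>y. g (\<xi>, y)) \<in> L2 N then L2_inner N (\<lambda>y. g (\<xi>, y)) (e j) else 0)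
      \<in> borel_measurable M" by measurable
  also have "(\<lambda>\<xi>. if (\<lambda>y. g (\<xi>, y)) \<in> L2 N then L2_inner N (\<lambda>y. g (\<xi>, y)) (e j) else 0) =
      (\<lambda>\<xi>. L2_inner N (\<lambda>y. if (\<lambda>y. g (\<xi>, y)) \<in> L2 N then g (\<xi>, y) else 0) (e j))"
    unfolding if_eq by (auto simp: L2_inner_def)
  finally show "(\<lambda>\<xi>. L2_inner N (\<lambda>y. if (\<lambda>y. g (\<xi>, y)) \<in> L2 N then g (\<xi>, y) else 0) (e j))
      \<in> borel_measurable M" .
qed

text \<open>Infima of nonempty sets in \<open>enat\<close> are attained, and the infimum of the
  empty set is \<infinity>; so dimension 0 means that the empty set is an orthonormal basis. Its
  only combination is 0, which approximates \<open>f\<close> arbitrarily well only if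
  \<open>f\<close> is null.\<close>

lemma L2_dim_eq_0_iff:
  assumes "S \<subseteq> L2 M"
  shows "L2_dim M S = 0 \<longleftrightarrow> (\<forall>f\<in>S. AE x in M. f x = 0)"
proof -
  have norm0: "(AE x in M. f x = 0) \<longleftrightarrow> L2_norm M f = 0" if "f \<in> S" for f
    using L2_norm_eq_0_iff assms that by blast
  have empty: "L2_onb M S (\<lambda>b. b) {} \<longleftrightarrow> (\<forall>f\<in>S. L2_norm M f = 0)"
  proof
    assume onb: "L2_onb M S (\<lambda>b. b) {}"
    show "\<forall>f\<in>S. L2_norm M f = 0"
    proof
      fix f assume "f \<in> S"
      then have "L2_norm M f < \<epsilon>" if "\<epsilon> > 0" for \<epsilon>
        using L2_onbD(3)[OF onb _ that, of f] by auto
      from this[of "L2_norm M f"] show "L2_norm M f = 0"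
        by (cases "L2_norm M f > 0") (use L2_norm_nonneg[of M f] in auto)
    qed
  qed (auto simp: L2_onb_def)
  let ?c = "\<lambda>B::('a \<Rightarrow> complex) set. if finite B then enat (card B) else \<infinity>"
  let ?A = "?c ` {B. L2_onb M S (\<lambda>b. b) B}"
  have c0: "?c B = 0 \<longleftrightarrow> B = {}" for B
    by (auto simp: zero_enat_def)
  have "Inf ?A = 0 \<longleftrightarrow> 0 \<in> ?A"
  proof
    assume 0: "Inf ?A = 0"
    then have "?A \<noteq> {}"
      by (metis Inf_empty i0_ne_infinity top_enat_def)
    then obtain c where "c \<in> ?A" by blast
    then have "Inf ?A \<in> ?A" by (rule wellorder_InfI)
    then show "0 \<in> ?A" by (simp only: 0)
  next
    assume "0 \<in> ?A"
    then have "Inf ?A \<le> 0" by (rule Inf_lower)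
    then show "Inf ?A = 0" by simp
  qed
  also have "0 \<in> ?A \<longleftrightarrow> L2_onb M S (\<lambda>b. b) {}"
    unfolding image_iff Bex_def mem_Collect_eq eq_commute[of 0 "?c _"] c0 by blast
  finally show ?thesis
    unfolding L2_dim_def empty using norm0 by blast
qed


section \<open>Measurable fields of projections\<close>

text \<open>Separates the decomposition of projections from Fourier analysis; \<open>M\<close> will
  be the dual Haar measure. The fibre data are constrained on \<open>space M\<close> only, as those
  of the theorem are on the dual group.\<close>

locale measurable_projection_field =
  fixes M :: "'x measure" and N :: "'y measure"
    and P :: "'x \<Rightarrow> ('y \<Rightarrow> complex) \<Rightarrow> 'y \<Rightarrow> complex"
    and e :: "nat \<Rightarrow> 'y \<Rightarrow> complex" and J :: "nat set"
    and K :: "'x \<Rightarrow> ('y \<Rightarrow> complex) set" and \<Omega> :: "'x set"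
  assumes N: "sigma_finite_measure N"
    and onb: "L2_onb N (L2 N) e J"
    and proj: "\<And>\<xi>. \<xi> \<in> space M \<Longrightarrow> L2_projection N (P \<xi>)"
    and P_measurable: "\<And>f g. f \<in> L2 N \<Longrightarrow> g \<in> L2 N \<Longrightarrow> (\<lambda>\<xi>. L2_inner N (P \<xi> f) g) \<in> borel_measurable M"
    and K_eq: "\<And>\<xi>. \<xi> \<in> space M \<Longrightarrow> K \<xi> = L2_image N (P \<xi>) (L2 N)"
    and \<Omega>_eq: "\<Omega> = {\<xi> \<in> space M. L2_dim N (K \<xi>) > 0}"
begin

lemma K_iff:
  assumes "\<xi> \<in> space M"
  shows "f \<in> K \<xi> \<longleftrightarrow> f \<in> L2 N \<and> (AE y in N. P \<xi> f y = f y)"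
  using assms L2_image_projection_iff[OF proj] by (simp add: K_eq)

lemma P_L2: "\<xi> \<in> space M \<Longrightarrow> f \<in> L2 N \<Longrightarrow> P \<xi> f \<in> L2 N"
  using L2_projectionD(2)[OF proj] .

lemma P_in_K: "\<xi> \<in> space M \<Longrightarrow> f \<in> L2 N \<Longrightarrow> P \<xi> f \<in> K \<xi>"
  by (simp add: K_iff P_L2 L2_projectionD(3)[OF proj])

text \<open>\<open>P \<xi>\<close> acts on representatives and may send 0 to a function that
  vanishes only almost everywhere. The lemma keeps extensions by zero inside the fibres.\<close>

lemma zero_in_K:
  assumes "\<xi> \<in> space M"
  shows "(\<lambda>y. 0) \<in> K \<xi>"
proof -
  have "L2_norm N (P \<xi> (\<lambda>y. 0)) \<le> L2_norm N (\<lambda>y. 0)"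
    using proj[OF assms] L2_zero by (rule L2_projection_norm_le)
  then have "L2_norm N (P \<xi> (\<lambda>y. 0)) = 0"
    using L2_norm_nonneg[of N "P \<xi> (\<lambda>y. 0)"] by (simp add: L2_norm_def[of N "\<lambda>y. 0"])
  then show ?thesis
    using K_iff[OF assms] L2_norm_eq_0_iff[OF P_L2[OF assms L2_zero]] by simp
qed

text \<open>Self-adjointness moves \<open>P \<xi>\<close> to \<open>f\<close>, which it fixes. Hence
  the fundamental sequence and the constant basis single out the same measurable fields.\<close>

lemma inner_P_basis:
  assumes "\<xi> \<in> space M" "f \<in> K \<xi>" "j \<in> J"
  shows "L2_inner N f (P \<xi> (e j)) = L2_inner N f (e j)"
proof -
  have f: "f \<in> L2 N" "AE y in N. P \<xi> f y = f y"
    using assms K_iff by auto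
  have ej: "e j \<in> L2 N"
    using onb assms(3) by (rule L2_onbD(1))
  have "L2_inner N f (P \<xi> (e j)) = L2_inner N (P \<xi> f) (e j)"
    using L2_projectionD(4)[OF proj[OF assms(1)] f(1) ej] by simp
  also have "\<dots> = L2_inner N f (e j)"
    by (rule L2_inner_cong_AE[OF f(2) AE_I2 P_L2[OF assms(1) f(1)] ej f(1) ej]) simp
  finally show ?thesis .
qed

lemma measurable_field_basis: "j \<in> J \<Longrightarrow> measurable_field M N e J (\<lambda>\<xi>. P \<xi> (e j))"
  using L2_onbD(1)[OF onb] P_L2 P_measurable by (auto simp: measurable_field_def)

text \<open>Measurability of \<open>P\<close> is assumed on fixed vectors only. Moving
  \<open>P \<xi>\<close> to the basis vector leaves an inner product of two measurable fields,
  \<open>k\<close> and the field of the \<open>P \<xi> (e j)\<close>.\<close>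

lemma measurable_field_P:
  assumes "measurable_field M N e J k"
  shows "measurable_field M N e J (\<lambda>\<xi>. P \<xi> (k \<xi>))"
  unfolding measurable_field_def
proof (intro conjI ballI)
  have k: "k \<xi> \<in> L2 N" if "\<xi> \<in> space M" for \<xi>
    using assms that by (simp add: measurable_field_def)
  then show "P \<xi> (k \<xi>) \<in> L2 N" if "\<xi> \<in> space M" for \<xi>
    using that P_L2 by blast
  fix j assume j: "j \<in> J"
  have "(\<lambda>\<xi>. L2_inner N (k \<xi>) (P \<xi> (e j))) \<in> borel_measurable M"
    using onb assms measurable_field_basis[OF j] by (rule measurable_field_inner)
  also have "?this \<longleftrightarrow> (\<lambda>\<xi>. L2_inner N (P \<xi> (k \<xi>)) (e j)) \<in> borel_measurable M"
    using k j L2_onbD(1)[OF onb] L2_projectionD(4)[OF proj] by (intro measurable_cong) simp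
  finally show "(\<lambda>\<xi>. L2_inner N (P \<xi> (k \<xi>)) (e j)) \<in> borel_measurable M" .
qed

text \<open>Turns the dimension condition into countably many measurable ones. If all
  \<open>P \<xi> (e j)\<close> are null, a vector of the fibre has zero coefficients, and Parseval
  makes it null.\<close>

lemma in_\<Omega>_iff:
  assumes \<xi>: "\<xi> \<in> space M"
  shows "\<xi> \<in> \<Omega> \<longleftrightarrow> (\<exists>j\<in>J. Re (L2_inner N (P \<xi> (e j)) (P \<xi> (e j))) \<noteq> 0)"
proof -
  have "K \<xi> \<subseteq> L2 N"
    using K_iff[OF \<xi>] by blast
  then have "\<xi> \<notin> \<Omega> \<longleftrightarrow> (\<forall>f\<in>K \<xi>. AE y in N. f y = 0)"
    using \<xi> L2_dim_eq_0_iff[of "K \<xi>" N] by (simp add: \<Omega>_eq)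
  also have "\<dots> \<longleftrightarrow> (\<forall>j\<in>J. L2_norm N (P \<xi> (e j)) = 0)"
  proof
    assume "\<forall>f\<in>K \<xi>. AE y in N. f y = 0"
    then show "\<forall>j\<in>J. L2_norm N (P \<xi> (e j)) = 0"
      using P_in_K[OF \<xi>] P_L2[OF \<xi>] L2_onbD(1)[OF onb] L2_norm_eq_0_iff by blast
  next
    assume 0: "\<forall>j\<in>J. L2_norm N (P \<xi> (e j)) = 0"
    show "\<forall>f\<in>K \<xi>. AE y in N. f y = 0"
    proof
      fix f assume f: "f \<in> K \<xi>"
      then have fL2: "f \<in> L2 N"
        using K_iff[OF \<xi>] by blast
      have "L2_inner N f (e j) = 0" if j: "j \<in> J" for j
      proof -
        have "cmod (L2_inner N f (P \<xi> (e j))) \<le> L2_norm N f * L2_norm N (P \<xi> (e j))"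
          using fL2 P_L2[OF \<xi>] L2_onbD(1)[OF onb j] by (intro L2_Cauchy_Schwarz)
        then show ?thesis
          using 0 j inner_P_basis[OF \<xi> f j] by simp
      qed
      then have "(\<lambda>n. 0) \<longlonglongrightarrow> (L2_norm N f)\<^sup>2"
        using Parseval_norm[OF onb fL2] by simp
      then have "L2_norm N f = 0"
        by (simp add: LIMSEQ_const_iff)
      then show "AE y in N. f y = 0"
        using L2_norm_eq_0_iff[OF fL2] by simp
    qed
  qed
  also have "\<dots> \<longleftrightarrow> (\<forall>j\<in>J. Re (L2_inner N (P \<xi> (e j)) (P \<xi> (e j))) = 0)"
    by (simp add: L2_inner_self)
  finally show ?thesis by blast
qed

lemma \<Omega>_subset: "\<Omega> \<subseteq> space M"
  by (auto simp: \<Omega>_eq)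

lemma \<Omega>_sets: "\<Omega> \<in> sets M"
proof -
  have "(\<lambda>\<xi>. L2_inner N (P \<xi> (e j)) (P \<xi> (e j))) \<in> borel_measurable M" if "j \<in> J" for j
    using measurable_field_inner[OF onb measurable_field_basis[OF that] measurable_field_basis[OF that]] .
  then have "{\<xi> \<in> space M. Re (L2_inner N (P \<xi> (e j)) (P \<xi> (e j))) \<noteq> 0} \<in> sets M" if "j \<in> J" for j
    using that by measurable
  then have "(\<Union>j\<in>J. {\<xi> \<in> space M. Re (L2_inner N (P \<xi> (e j)) (P \<xi> (e j))) \<noteq> 0}) \<in> sets M"
    by (intro sets.countable_UN') auto
  also have "(\<Union>j\<in>J. {\<xi> \<in> space M. Re (L2_inner N (P \<xi> (e j)) (P \<xi> (e j))) \<noteq> 0}) = \<Omega>"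
    using in_\<Omega>_iff \<Omega>_subset by blast
  finally show ?thesis .
qed

lemma K_trivial_outside_\<Omega>:
  assumes "\<xi> \<in> space M" "\<xi> \<notin> \<Omega>" "f \<in> K \<xi>"
  shows "AE y in N. f y = 0"
proof -
  have "L2_dim N (K \<xi>) = 0"
    using assms(1,2) by (simp add: \<Omega>_eq)
  moreover have "K \<xi> \<subseteq> L2 N"
    using K_iff[OF assms(1)] by blast
  ultimately show ?thesis
    using L2_dim_eq_0_iff assms(3) by blast
qed

abbreviation fields :: "('x \<Rightarrow> 'y \<Rightarrow> complex) set" where
  "fields \<equiv> direct_integral (restrict_space M \<Omega>) N K (\<lambda>j \<xi>. P \<xi> (e j)) J"

lemma space_restrict_\<Omega>: "space (restrict_space M \<Omega>) = \<Omega>"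
  using \<Omega>_subset by (auto simp: space_restrict_space)

text \<open>Passes from fields over \<open>\<Omega>\<close>, tested against
  \<open>P \<xi> (e j)\<close>, to fields over all of \<open>space M\<close>, tested against
  \<open>e j\<close>; the coefficients agree on \<open>\<Omega>\<close> and vanish
  elsewhere.\<close>

lemma extended_field:
  assumes "k \<in> fields"
  shows "measurable_field M N e J (extend_by_zero \<Omega> k)"
    and "\<And>\<xi>. \<xi> \<in> space M \<Longrightarrow> extend_by_zero \<Omega> k \<xi> \<in> K \<xi>"
    and "integrable M (\<lambda>\<xi>. (L2_norm N (extend_by_zero \<Omega> k \<xi>))\<^sup>2)"
proof -
  have k: "\<And>\<xi>. \<xi> \<in> \<Omega> \<Longrightarrow> k \<xi> \<in> K \<xi>"
      "\<And>j. j \<in> J \<Longrightarrow> (\<lambda>\<xi>. L2_inner N (k \<xi>) (P \<xi> (e j))) \<in> borel_measurable (restrict_space M \<Omega>)"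
      "integrable (restrict_space M \<Omega>) (\<lambda>\<xi>. (L2_norm N (k \<xi>))\<^sup>2)"
    using assms by (auto simp: direct_integral_def space_restrict_\<Omega>)
  have \<Omega>: "\<Omega> \<inter> space M \<in> sets M"
    using \<Omega>_sets by simp
  show K: "extend_by_zero \<Omega> k \<xi> \<in> K \<xi>" if "\<xi> \<in> space M" for \<xi>
    using that k(1) zero_in_K by (simp add: extend_by_zero_def)
  show "measurable_field M N e J (extend_by_zero \<Omega> k)"
    unfolding measurable_field_def
  proof (intro conjI ballI)
    show "extend_by_zero \<Omega> k \<xi> \<in> L2 N" if "\<xi> \<in> space M" for \<xi>
      using K[OF that] K_iff[OF that] by blast
    fix j assume j: "j \<in> J"
    have "(\<lambda>\<xi>. if \<xi> \<in> \<Omega> then L2_inner N (k \<xi>) (P \<xi> (e j)) else 0) \<in> borel_measurable M"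
      using k(2)[OF j] by (subst measurable_restrict_space_iff[OF \<Omega>, symmetric]) auto
    also have "(\<lambda>\<xi>. if \<xi> \<in> \<Omega> then L2_inner N (k \<xi>) (P \<xi> (e j)) else 0) =
        (\<lambda>\<xi>. L2_inner N (extend_by_zero \<Omega> k \<xi>) (e j))"
    proof
      fix \<xi>
      show "(if \<xi> \<in> \<Omega> then L2_inner N (k \<xi>) (P \<xi> (e j)) else 0) =
          L2_inner N (extend_by_zero \<Omega> k \<xi>) (e j)"
      proof (cases "\<xi> \<in> \<Omega>")
        case True
        then show ?thesis
          using inner_P_basis[OF _ k(1) j] \<Omega>_subset by (auto simp: extend_by_zero_def)
      next
        case False
        then show ?thesis by (simp add: extend_by_zero_def L2_inner_def)
      qed
    qed
    finally show "(\<lambda>\<xi>. L2_inner N (extend_by_zero \<Omega> k \<xi>) (e j)) \<in> borel_measurable M" .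
  qed
  have "integrable M (\<lambda>\<xi>. indicator \<Omega> \<xi> *\<^sub>R (L2_norm N (k \<xi>))\<^sup>2)"
    by (rule iffD1[OF integrable_restrict_space[OF \<Omega>] k(3)])
  also have "(\<lambda>\<xi>. indicator \<Omega> \<xi> *\<^sub>R (L2_norm N (k \<xi>))\<^sup>2) = (\<lambda>\<xi>. (L2_norm N (extend_by_zero \<Omega> k \<xi>))\<^sup>2)"
    by (rule ext) (simp add: extend_by_zero_def L2_norm_def indicator_def)
  finally show "integrable M (\<lambda>\<xi>. (L2_norm N (extend_by_zero \<Omega> k \<xi>))\<^sup>2)" .
qed

lemma in_fieldsI:
  assumes k: "measurable_field M N e J k" and K: "\<And>\<xi>. \<xi> \<in> space M \<Longrightarrow> k \<xi> \<in> K \<xi>"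
    and int: "integrable M (\<lambda>\<xi>. (L2_norm N (k \<xi>))\<^sup>2)"
  shows "k \<in> fields"
  unfolding direct_integral_def
proof (intro CollectI conjI ballI)
  show "k \<xi> \<in> K \<xi>" if "\<xi> \<in> space (restrict_space M \<Omega>)" for \<xi>
    using that K by (simp add: space_restrict_space)
  show "(\<lambda>\<xi>. L2_inner N (k \<xi>) (P \<xi> (e j))) \<in> borel_measurable (restrict_space M \<Omega>)" if "j \<in> J" for j
    using measurable_field_inner[OF onb k measurable_field_basis[OF that]]
    by (rule measurable_restrict_space1)
  have \<Omega>: "\<Omega> \<inter> space M \<in> sets M"
    using \<Omega>_sets by simp
  show "integrable (restrict_space M \<Omega>) (\<lambda>\<xi>. (L2_norm N (k \<xi>))\<^sup>2)"
    unfolding integrable_restrict_space[OF \<Omega>] using \<Omega>_sets int by (rule integrable_mult_indicator)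
qed

text \<open>By Fubini the inner product is the integral of the inner products of sections; outside
  \<open>\<Omega>\<close> the extended fields are 0, so only the integral over
  \<open>\<Omega>\<close> remains.\<close>

lemma direct_integral_inner_eq:
  assumes g: "g1 \<in> L2 (M \<Otimes>\<^sub>M N)" "g2 \<in> L2 (M \<Otimes>\<^sub>M N)" and h: "h1 \<in> fields" "h2 \<in> fields"
    and eq: "family_eq M N (curry g1) (extend_by_zero \<Omega> h1)" "family_eq M N (curry g2) (extend_by_zero \<Omega> h2)"
  shows "L2_inner (M \<Otimes>\<^sub>M N) g1 g2 = direct_integral_inner (restrict_space M \<Omega>) N h1 h2"
proof -
  let ?h1 = "extend_by_zero \<Omega> h1" and ?h2 = "extend_by_zero \<Omega> h2"
  have \<Omega>: "\<Omega> \<inter> space M \<in> sets M"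
    using \<Omega>_sets by simp
  have "L2_inner (M \<Otimes>\<^sub>M N) g1 g2 = (LINT \<xi>|M. L2_inner N (\<lambda>y. g1 (\<xi>, y)) (\<lambda>y. g2 (\<xi>, y)))"
    using N g by (rule L2_inner_pair)
  also have "\<dots> = (LINT \<xi>|M. L2_inner N (?h1 \<xi>) (?h2 \<xi>))"
  proof (rule integral_cong_AE)
    show "(\<lambda>\<xi>. L2_inner N (\<lambda>y. g1 (\<xi>, y)) (\<lambda>y. g2 (\<xi>, y))) \<in> borel_measurable M"
      using N g[THEN L2_measurable] by (rule measurable_L2_inner_sections)
    show "(\<lambda>\<xi>. L2_inner N (?h1 \<xi>) (?h2 \<xi>)) \<in> borel_measurable M"
      using onb extended_field(1)[OF h(1)] extended_field(1)[OF h(2)] by (rule measurable_field_inner)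
    show "AE \<xi> in M. L2_inner N (\<lambda>y. g1 (\<xi>, y)) (\<lambda>y. g2 (\<xi>, y)) = L2_inner N (?h1 \<xi>) (?h2 \<xi>)"
      using eq[unfolded family_eq_def] L2_sections[OF N g(1)] L2_sections[OF N g(2)] AE_space
    proof eventually_elim
      case (elim \<xi>)
      have "?h1 \<xi> \<in> L2 N" "?h2 \<xi> \<in> L2 N"
        using extended_field(2)[OF h(1) elim(5)] extended_field(2)[OF h(2) elim(5)] K_iff[OF elim(5)] by auto
      then show ?case
        using elim by (intro L2_inner_cong_AE) simp_all
    qed
  qed
  also have "\<dots> = (LINT \<xi>|M. indicator \<Omega> \<xi> *\<^sub>R L2_inner N (h1 \<xi>) (h2 \<xi>))"
    by (intro Bochner_Integration.integral_cong)
      (auto simp: extend_by_zero_def L2_inner_def[of _ "\<lambda>y. 0"])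
  also have "\<dots> = direct_integral_inner (restrict_space M \<Omega>) N h1 h2"
    unfolding direct_integral_inner_def integral_restrict_space[OF \<Omega>] ..
  finally show ?thesis .
qed

lemma families_eq_direct_integral:
  assumes T_L2: "\<And>g. g \<in> L2 (M \<Otimes>\<^sub>M N) \<Longrightarrow> T g \<in> L2 (M \<Otimes>\<^sub>M N)"
    and T: "\<And>g. g \<in> L2 (M \<Otimes>\<^sub>M N) \<Longrightarrow> AE \<xi> in M. AE y in N. T g (\<xi>, y) = P \<xi> (\<lambda>v. g (\<xi>, v)) y"
    and A: "A = {g \<in> L2 (M \<Otimes>\<^sub>M N). AE z in M \<Otimes>\<^sub>M N. T g z = g z}"
  shows "families_of_functions M N A = families_extended_by_zero M N \<Omega> fields"
proof (intro equalityI subsetI)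
  fix h assume "h \<in> families_of_functions M N A"
  then obtain g where hL2: "\<forall>\<xi>\<in>space M. h \<xi> \<in> L2 N" and "g \<in> A"
    and eq: "AE \<xi> in M. AE y in N. h \<xi> y = g (\<xi>, y)"
    by (auto simp: families_of_functions_def family_eq_def)
  then have g: "g \<in> L2 (M \<Otimes>\<^sub>M N)" and Tg: "AE z in M \<Otimes>\<^sub>M N. T g z = g z"
    by (auto simp: A)
  \<comment> \<open>These have the required properties at every \<xi> and not just almost every one:
    \<open>g'\<close> lies in L2, and \<open>P \<xi>\<close> forces it into the fibre. As
    \<open>T g\<close> is \<open>g\<close>, almost every \<open>k \<xi>\<close> still represents the
    section of \<open>g\<close>.\<close>
  define g' where "g' \<xi> y = (if (\<lambda>y. g (\<xi>, y)) \<in> L2 N then g (\<xi>, y) else 0)" for \<xi> y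
  define k where "k \<xi> = P \<xi> (g' \<xi>)" for \<xi>
  have g': "measurable_field M N e J g'"
    unfolding g'_def[abs_def] using N onb g by (rule section_measurable_field)
  then have g'L2: "g' \<xi> \<in> L2 N" if "\<xi> \<in> space M" for \<xi>
    using that by (simp add: measurable_field_def)
  have k: "measurable_field M N e J k"
    unfolding k_def[abs_def] using g' by (rule measurable_field_P)
  have kK: "k \<xi> \<in> K \<xi>" if "\<xi> \<in> space M" for \<xi>
    unfolding k_def using that g'L2 by (intro P_in_K)
  have "integrable M (\<lambda>\<xi>. (L2_norm N (k \<xi>))\<^sup>2)"
  proof (rule Bochner_Integration.integrable_bound)
    show "integrable M (\<lambda>\<xi>. LINT y|N. (cmod (g (\<xi>, y)))\<^sup>2)"
      using N L2_integrable_square[OF g] by (rule Fubini_nonneg(2)) simp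
    show "(\<lambda>\<xi>. (L2_norm N (k \<xi>))\<^sup>2) \<in> borel_measurable M"
      using onb k by (rule measurable_field_norm_square)
    show "AE \<xi> in M. norm ((L2_norm N (k \<xi>))\<^sup>2) \<le> norm (LINT y|N. (cmod (g (\<xi>, y)))\<^sup>2)"
      using L2_sections[OF N g] AE_space
    proof eventually_elim
      case (elim \<xi>)
      then have "g' \<xi> = (\<lambda>y. g (\<xi>, y))"
        by (simp add: g'_def[abs_def])
      moreover have "L2_norm N (k \<xi>) \<le> L2_norm N (g' \<xi>)"
        unfolding k_def using elim g'L2 by (intro L2_projection_norm_le proj)
      ultimately have "(L2_norm N (k \<xi>))\<^sup>2 \<le> (L2_norm N (\<lambda>y. g (\<xi>, y)))\<^sup>2"
        by (intro power_mono) auto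
      then show ?case by (simp add: L2_norm_square)
    qed
  qed
  with k kK have kD: "k \<in> fields"
    by (rule in_fieldsI)
  have "AE \<xi> in M. AE y in N. h \<xi> y = extend_by_zero \<Omega> k \<xi> y"
    using eq T[OF g] AE_pair_sections[OF N Tg] L2_sections[OF N g] AE_space
  proof eventually_elim
    case (elim \<xi>)
    then have g'_eq: "g' \<xi> = (\<lambda>y. g (\<xi>, y))"
      by (simp add: g'_def[abs_def])
    have 1: "AE y in N. h \<xi> y = k \<xi> y"
      using elim(1,2,3) by eventually_elim (simp add: k_def g'_eq)
    show ?case
    proof (cases "\<xi> \<in> \<Omega>")
      case True
      with 1 show ?thesis by (simp add: extend_by_zero_def)
    next
      case False
      \<comment> \<open>Outside \<open>\<Omega>\<close> the representative \<open>k \<xi>\<close>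
        need not be the zero function, but it is null, since the fibre has dimension 0.\<close>
      then have "AE y in N. k \<xi> y = 0"
        using elim(5) kK by (intro K_trivial_outside_\<Omega>)
      with 1 have "AE y in N. h \<xi> y = 0"
        by eventually_elim simp
      with False show ?thesis by (simp add: extend_by_zero_def)
    qed
  qed
  then show "h \<in> families_extended_by_zero M N \<Omega> fields"
    using hL2 kD by (auto simp: families_extended_by_zero_def family_eq_def)
next
  fix h assume "h \<in> families_extended_by_zero M N \<Omega> fields"
  then obtain k0 where hL2: "\<forall>\<xi>\<in>space M. h \<xi> \<in> L2 N" and k0: "k0 \<in> fields"
    and eq: "AE \<xi> in M. AE y in N. h \<xi> y = extend_by_zero \<Omega> k0 \<xi> y"
    unfolding families_extended_by_zero_def family_eq_def by blast
  define k where "k = extend_by_zero \<Omega> k0"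
  note k = extended_field[OF k0, folded k_def]
  obtain g where g: "g \<in> L2 (M \<Otimes>\<^sub>M N)" and gk: "\<And>\<xi>. \<xi> \<in> space M \<Longrightarrow> AE y in N. g (\<xi>, y) = k \<xi> y"
    using measurable_field_joint_representative[OF N onb k(1,3)] by blast
  have "AE z in M \<Otimes>\<^sub>M N. T g z = g z"
  proof (rule AE_pair_if_sections[OF N])
    note [measurable] = L2_measurable[OF g] L2_measurable[OF T_L2[OF g]]
    show "{z \<in> space (M \<Otimes>\<^sub>M N). T g z = g z} \<in> sets (M \<Otimes>\<^sub>M N)"
      by measurable
    show "AE \<xi> in M. AE y in N. T g (\<xi>, y) = g (\<xi>, y)"
      using T[OF g] L2_sections[OF N g] AE_space
    proof eventually_elim
      case (elim \<xi>)
      have kL2: "k \<xi> \<in> L2 N" and Pk: "AE y in N. P \<xi> (k \<xi>) y = k \<xi> y"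
        using k(2)[OF elim(3)] K_iff[OF elim(3)] by auto
      \<comment> \<open>\<open>T\<close> acts on the section of \<open>g\<close>, not on
        \<open>k \<xi>\<close>; the two agree almost everywhere, and a bounded operator respects
        that.\<close>
      have "AE y in N. P \<xi> (\<lambda>v. g (\<xi>, v)) y = P \<xi> (k \<xi>) y"
        by (rule L2_operator_cong_AE[OF L2_projectionD(1)[OF proj[OF elim(3)]] elim(2) kL2 gk[OF elim(3)]])
      with elim(1) Pk gk[OF elim(3)] show ?case
        by eventually_elim simp
    qed
  qed
  with g have gA: "g \<in> A"
    by (simp add: A)
  have "AE \<xi> in M. AE y in N. h \<xi> y = g (\<xi>, y)"
    using eq AE_space
  proof eventually_elim
    case (elim \<xi>)
    from elim(1) gk[OF elim(2)] show ?case
      by eventually_elim (simp add: k_def)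
  qed
  then have "family_eq M N h (curry g)"
    by (simp add: family_eq_def)
  then show "h \<in> families_of_functions M N A"
    using hL2 gA unfolding families_of_functions_def by blast
qed

end

section \<open>Application to the dual group\<close>

lemma topspace_dual_topology:
  "topspace (dual_topology :: ('g::topological_ab_group_add \<Rightarrow> complex) topology) = dual_group"
proof -
  \<comment> \<open>The empty compact set puts no condition on \<xi>, so the whole dual group is one
    of the generating sets.\<close>
  have "dual_group = {\<xi> \<in> dual_group. \<xi> ` {} \<subseteq> (UNIV :: complex set)}"
    by simp
  then have "dual_group \<in> {{\<xi> \<in> (dual_group :: ('g \<Rightarrow> complex) set). \<xi> ` K \<subseteq> U} |K U. compact K \<and> open U}"
    by (intro CollectI exI[of _ "{}"] exI[of _ UNIV]) auto
  then show ?thesis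
    unfolding dual_topology_def topology_generated_by_topspace by auto
qed

text \<open>Equality of the sets of families alone would forget the Hilbert space structure; the
  second conjunct makes the identification preserve inner products.\<close>

theorem proposition5p4:
  fixes \<nu> :: "'g::topological_ab_group_add measure"
    and \<nu>' :: "('g \<Rightarrow> complex) measure"
    and lam :: "'y measure"
    and F :: "('g \<Rightarrow> complex) \<Rightarrow> ('g \<Rightarrow> complex) \<Rightarrow> complex"
    and FI :: "('g \<times> 'y \<Rightarrow> complex) \<Rightarrow> ('g \<Rightarrow> complex) \<times> 'y \<Rightarrow> complex"
    and FI_adj :: "(('g \<Rightarrow> complex) \<times> 'y \<Rightarrow> complex) \<Rightarrow> 'g \<times> 'y \<Rightarrow> complex"
    and H :: "('g \<times> 'y \<Rightarrow> complex) set"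
    and P :: "('g \<times> 'y \<Rightarrow> complex) \<Rightarrow> 'g \<times> 'y \<Rightarrow> complex"
    and H_hat :: "(('g \<Rightarrow> complex) \<times> 'y \<Rightarrow> complex) set"
    and P_hat :: "('g \<Rightarrow> complex) \<Rightarrow> ('y \<Rightarrow> complex) \<Rightarrow> 'y \<Rightarrow> complex"
    and H_fib :: "('g \<Rightarrow> complex) \<Rightarrow> ('y \<Rightarrow> complex) set"
    and d :: "('g \<Rightarrow> complex) \<Rightarrow> enat"
    and \<Omega> :: "('g \<Rightarrow> complex) set"
    and e :: "nat \<Rightarrow> 'y \<Rightarrow> complex"
    and J :: "nat set"
  assumes "locally_compact_space (euclidean :: 'g topology)"
    and "metrizable_space (euclidean :: 'g topology)"
    and "sigma_compact (UNIV :: 'g set)"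
    and "haar_measure euclidean (+) \<nu>"
    and "sigma_finite_measure lam"
    and "L2_separable \<nu>"
    and "L2_separable lam"
    and "dual_haar_measure \<nu> \<nu>'"
    and "fourier_L2 \<nu> \<nu>' F"
    and "L2_tensor_id \<nu> \<nu>' lam F FI"
    and "L2_adjoint (\<nu> \<Otimes>\<^sub>M lam) (\<nu>' \<Otimes>\<^sub>M lam) FI FI_adj"
    and "L2_closed_subspace (\<nu> \<Otimes>\<^sub>M lam) H"
    and "\<And>a f. f \<in> H \<Longrightarrow> (\<lambda>(u, v). f (u - a, v)) \<in> H"
    and "H_hat = L2_image (\<nu>' \<Otimes>\<^sub>M lam) FI H"
    and "L2_projection (\<nu> \<Otimes>\<^sub>M lam) P"
    and "L2_image (\<nu> \<Otimes>\<^sub>M lam) P (L2 (\<nu> \<Otimes>\<^sub>M lam)) = H"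
    and "\<And>\<xi>. \<xi> \<in> dual_group \<Longrightarrow> L2_projection lam (P_hat \<xi>)"
    and "direct_integral_operator \<nu>' lam P_hat (\<lambda>g. FI (P (FI_adj g)))"
    and "\<And>\<xi>. \<xi> \<in> dual_group \<Longrightarrow> H_fib \<xi> = L2_image lam (P_hat \<xi>) (L2 lam)"
    and "\<And>\<xi>. \<xi> \<in> dual_group \<Longrightarrow> d \<xi> = L2_dim lam (H_fib \<xi>)"
    and "\<Omega> = {\<xi> \<in> dual_group. d \<xi> > 0}"
    and "L2_onb lam (L2 lam) e J"
  shows "families_of_functions \<nu>' lam H_hat =
           families_extended_by_zero \<nu>' lam \<Omega>
             (direct_integral (restrict_space \<nu>' \<Omega>) lam H_fib (\<lambda>j \<xi>. P_hat \<xi> (e j)) J) \<and>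
         (\<forall>g1\<in>H_hat. \<forall>g2\<in>H_hat.
           \<forall>h1\<in>direct_integral (restrict_space \<nu>' \<Omega>) lam H_fib (\<lambda>j \<xi>. P_hat \<xi> (e j)) J.
           \<forall>h2\<in>direct_integral (restrict_space \<nu>' \<Omega>) lam H_fib (\<lambda>j \<xi>. P_hat \<xi> (e j)) J.
             family_eq \<nu>' lam (curry g1) (extend_by_zero \<Omega> h1) \<longrightarrow>
             family_eq \<nu>' lam (curry g2) (extend_by_zero \<Omega> h2) \<longrightarrow>
             L2_inner (\<nu>' \<Otimes>\<^sub>M lam) g1 g2 =
               direct_integral_inner (restrict_space \<nu>' \<Omega>) lam h1 h2)"
proof -
  note lam = assms(5) and FI = assms(10) and adj = assms(11) and H_hat = assms(14)
    and P = assms(15) and P_image = assms(16)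
  let ?GY = "\<nu> \<Otimes>\<^sub>M lam" and ?DY = "\<nu>' \<Otimes>\<^sub>M lam"
  let ?T = "\<lambda>g. FI (P (FI_adj g))"
  have space: "space \<nu>' = dual_group"
    using assms(8) topspace_dual_topology by (auto simp: dual_haar_measure_def haar_measure_def)
  have FI_op: "L2_operator ?GY ?DY FI" and adj_op: "L2_operator ?DY ?GY FI_adj"
    using FI adj by (auto simp: L2_tensor_id_def L2_adjoint_def)
  note P_op = L2_projectionD(1)[OF P] and P_L2 = L2_projectionD(2)[OF P]
  note FI_L2 = L2_operator_L2[OF FI_op] and adj_L2 = L2_operator_L2[OF adj_op]
  have T_L2: "?T g \<in> L2 ?DY" if "g \<in> L2 ?DY" for g
    using that by (intro FI_L2 P_L2 adj_L2)
  have inverse: "AE z in ?GY. FI_adj (FI f) z = f z" if "f \<in> L2 ?GY" for f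
    using that assms(9)
    by (intro L2_tensor_id_adjoint_inverse[OF sigma_finite_haar_measure[OF assms(4,2,3)] lam _ FI adj])
      (auto simp: fourier_L2_def)
  have H_iff: "f \<in> H \<longleftrightarrow> f \<in> L2 ?GY \<and> (AE z in ?GY. P f z = f z)" for f
    using L2_image_projection_iff[OF P] P_image by simp
  \<comment> \<open>Forward, the left inverse \<open>FI_adj\<close> recovers \<open>f\<close> from
    \<open>g\<close> up to a null set, and \<open>P\<close> fixes it. Backward, \<open>?T g\<close>
    itself exhibits \<open>g\<close> as the image of \<open>P (FI_adj g)\<close>, which lies in
    \<open>H\<close>.\<close>
  have H_hat_eq: "H_hat = {g \<in> L2 ?DY. AE z in ?DY. ?T g z = g z}"
  proof (intro equalityI subsetI CollectI conjI)
    fix g assume "g \<in> H_hat"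
    then obtain f where g: "g \<in> L2 ?DY" and f: "f \<in> H" and gf: "AE z in ?DY. g z = FI f z"
      unfolding H_hat L2_image_def by blast
    have fL2: "f \<in> L2 ?GY" and Pf: "AE z in ?GY. P f z = f z"
      using f H_iff by auto
    have "AE z in ?GY. FI_adj g z = FI_adj (FI f) z"
      by (rule L2_operator_cong_AE[OF adj_op g FI_L2[OF fL2] gf])
    then have "AE z in ?GY. FI_adj g z = f z"
      using inverse[OF fL2] by eventually_elim simp
    then have "AE z in ?GY. P (FI_adj g) z = P f z"
      by (rule L2_operator_cong_AE[OF P_op adj_L2[OF g] fL2])
    then have "AE z in ?GY. P (FI_adj g) z = f z"
      using Pf by eventually_elim simp
    then have "AE z in ?DY. ?T g z = FI f z"
      by (rule L2_operator_cong_AE[OF FI_op P_L2[OF adj_L2[OF g]] fL2])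
    then show "AE z in ?DY. ?T g z = g z"
      using gf by eventually_elim simp
    show "g \<in> L2 ?DY" by fact
  next
    fix g assume "g \<in> {g \<in> L2 ?DY. AE z in ?DY. ?T g z = g z}"
    then have g: "g \<in> L2 ?DY" and "AE z in ?DY. ?T g z = g z" by auto
    then have "AE z in ?DY. g z = FI (P (FI_adj g)) z"
      by (auto elim: AE_mp)
    moreover have "P (FI_adj g) \<in> H"
      unfolding H_iff using P_L2 adj_L2[OF g] L2_projectionD(3)[OF P] by blast
    ultimately show "g \<in> H_hat"
      unfolding H_hat L2_image_def using g by blast
  qed
  interpret measurable_projection_field \<nu>' lam P_hat e J H_fib \<Omega>
  proof (rule measurable_projection_field.intro)
    show "sigma_finite_measure lam" "L2_onb lam (L2 lam) e J" by fact+
    show "L2_projection lam (P_hat \<xi>)" if "\<xi> \<in> space \<nu>'" for \<xi>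
      using that assms(17) by (simp add: space)
    show "(\<lambda>\<xi>. L2_inner lam (P_hat \<xi> f) g) \<in> borel_measurable \<nu>'" if "f \<in> L2 lam" "g \<in> L2 lam" for f g
      using that assms(18) by (simp add: direct_integral_operator_def)
    show "H_fib \<xi> = L2_image lam (P_hat \<xi>) (L2 lam)" if "\<xi> \<in> space \<nu>'" for \<xi>
      using that assms(19) by (simp add: space)
    show "\<Omega> = {\<xi> \<in> space \<nu>'. L2_dim lam (H_fib \<xi>) > 0}"
      using assms(20) by (auto simp: assms(21) space)
  qed
  have "families_of_functions \<nu>' lam H_hat = families_extended_by_zero \<nu>' lam \<Omega> fields"
    using T_L2 assms(18) H_hat_eq
    by (intro families_eq_direct_integral[where T = ?T]) (auto simp: direct_integral_operator_def)
  moreover have "H_hat \<subseteq> L2 ?DY"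
    by (auto simp: H_hat L2_image_def)
  ultimately show ?thesis
    using direct_integral_inner_eq by blast
qed

end
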